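(* Let $\rightsquigarrow$ be a 6-eternal relation, $G$ a finite group, $p$ a prime divisor of $|G|$, and $S$ a Sylow $p$-subgroup of $G$. Suppose that there exists a subgroup $D$ of $S$ with $1\le|D|<|S|$ such that every subgroup of $S$ of order $|D|$ or $p|D|$ is abelian, and every subgroup $H$ of $S$ of order $|D|$ satisfies $H\rightsquigarrow G$. Then $\mathcal{F}_S(G)$ is supersolvable.
   Context: All groups are finite. $Z_{\mathfrak{U}}(G)$ denotes the supersolvable hypercenter of $G$: the largest normal subgroup $N$ of $G$ such that every chief factor of $G$ below $N$ is cyclic (of prime order). $O_p(G)$ denotes the largest normal $p$-subgroup of $G$. Let $\rightsquigarrow$ be a relation, defined for every finite group $G$, between subgroups $H\le G$ and $G$ (written $H\rightsquigarrow G$). It is called 6-eternal if for every finite group $G$ the following hold: (0) for all subgroups $H\le K\le G$, if $H\rightsquigarrow G$ then $H\rightsquigarrow K$; (6) for every odd prime divisor $p$ of $|G|$: if there exists a subgroup $D$ of $O_p(G)$ with $1\le|D|<|O_p(G)|$ such that every subgroup $H$ of $O_p(G)$ of order $|D|$ satisfies $H\rightsquigarrow G$, then $O_p(G)\le Z_{\mathfrak{U}}(G)$. $\mathcal{F}_S(G)$ is the (saturated) fusion system on $S\in\mathrm{Syl}_p(G)$ whose objects are the subgroups of $S$ and whose morphisms $P\to Q$ are the maps $x\mapsto x^g$ with $g\in G$, $P^g\le Q$. A saturated fusion system $\mathcal{F}$ on a $p$-group $S$ is supersolvable if there is a series $1=S_0\le S_1\le\cdots\le S_n=S$ of strongly $\mathcal{F}$-closed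 subgroups of $S$ with $S_{i+1}/S_i$ cyclic for $0\le i\le n-1$. (A subgroup $T\le S$ is strongly $\mathcal{F}$-closed if for every $P\le T$ and every $\phi\in\mathrm{Hom}_{\mathcal{F}}(P,S)$ one has $P^{\phi}\le T$.)
   Formalization: The prime p is assumed odd: condition (6) concerns only odd primes, and the claim fails for p = 2 (let H ⇝ G mean that |H| is even, G = A_4, S = V_4, |D| = 2). *)

theory Defs
  imports "HOL-Algebra.Elementary_Groups" "HOL-Computational_Algebra.Primes"
begin

section \<open>Sylow subgroups, the largest normal p-subgroup and the supersolvable hypercenter\<close>

text \<open>
  A subgroup \<open>K\<close> of \<open>G\<close>, regarded as a group, is \<open>G\<lparr>carrier := K\<rparr>\<close>. All notions below are
  meant for finite groups. The operator \<^const>\<open>Greatest\<close> is taken with respect to inclusion;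
  in both uses the greatest element exists when \<open>G\<close> is finite, since the subgroups in question are
  closed under products.
\<close>

definition sylow_subgroup :: "'a monoid \<Rightarrow> nat \<Rightarrow> 'a set \<Rightarrow> bool" where
  "sylow_subgroup G p S \<longleftrightarrow> subgroup S G \<and> card S = p ^ multiplicity p (order G)"

definition p_core :: "'a monoid \<Rightarrow> nat \<Rightarrow> 'a set" where
  "p_core G p = (GREATEST N. N \<lhd> G \<and> (\<exists>n. card N = p ^ n))"

definition chief_factor :: "'a monoid \<Rightarrow> 'a set \<Rightarrow> 'a set \<Rightarrow> bool" where
  "chief_factor G H K \<longleftrightarrow> H \<lhd> G \<and> K \<lhd> G \<and> K \<subset> H \<and> \<not> (\<exists>N. N \<lhd> G \<and> K \<subset> N \<and> N \<subset> H)"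

definition supersolvable_hypercenter :: "'a monoid \<Rightarrow> 'a set" where
  "supersolvable_hypercenter G =
     (GREATEST N. N \<lhd> G \<and>
        (\<forall>H K. chief_factor G H K \<and> H \<subseteq> N \<longrightarrow>
           cyclic_group (G\<lparr>carrier := H\<rparr> Mod K) \<and> prime (order (G\<lparr>carrier := H\<rparr> Mod K))))"

section \<open>6-eternal relations\<close>

text \<open>
  \<open>R H G\<close> stands for \<open>H \<leadsto> G\<close>. The relation ranges over all finite groups with elements in an
  arbitrary type \<open>'a\<close>; its values at pairs where \<open>G\<close> is not a finite group or \<open>H\<close> is not
  a subgroup of \<open>G\<close> are irrelevant. Isomorphism invariance is not assumed.

  The second condition only concerns odd primes. Hence a 6-eternal relation carries no information
  on 2-fusion: the relation ``\<open>H\<close> has even order'' is 6-eternal.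
\<close>

definition six_eternal :: "('a set \<Rightarrow> 'a monoid \<Rightarrow> bool) \<Rightarrow> bool" where
  "six_eternal R \<longleftrightarrow>
     (\<forall>G. group G \<and> finite (carrier G) \<longrightarrow>
        (\<forall>H K. subgroup K G \<and> subgroup H (G\<lparr>carrier := K\<rparr>) \<and> R H G \<longrightarrow>
           R H (G\<lparr>carrier := K\<rparr>)) \<and>
        (\<forall>p. prime p \<and> odd p \<and> p dvd order G \<longrightarrow>
           (\<exists>D. subgroup D (G\<lparr>carrier := p_core G p\<rparr>) \<and>
                1 \<le> card D \<and> card D < card (p_core G p) \<and>
                (\<forall>H. subgroup H (G\<lparr>carrier := p_core G p\<rparr>) \<and> card H = card D \<longrightarrow> R H G)) \<longrightarrow>
           p_core G p \<subseteq> supersolvable_hypercenter G))"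

section \<open>Fusion systems\<close>

text \<open>
  A fusion system on \<open>S\<close> is given by its family of morphism sets \<open>F P Q\<close>, where \<open>P\<close> and
  \<open>Q\<close> range over the subgroups of \<open>S\<close>; morphisms are functions restricted to their domain.
\<close>

type_synonym 'a fusion = "'a set \<Rightarrow> 'a set \<Rightarrow> ('a \<Rightarrow> 'a) set"

definition group_fusion :: "'a monoid \<Rightarrow> 'a set \<Rightarrow> 'a fusion" where
  "group_fusion G S P Q =
     {restrict (\<lambda>x. inv\<^bsub>G\<^esub> g \<otimes>\<^bsub>G\<^esub> x \<otimes>\<^bsub>G\<^esub> g) P | g.
        g \<in> carrier G \<and> subgroup P (G\<lparr>carrier := S\<rparr>) \<and> subgroup Q (G\<lparr>carrier := S\<rparr>) \<and>
        (\<lambda>x. inv\<^bsub>G\<^esub> g \<otimes>\<^bsub>G\<^esub> x \<otimes>\<^bsub>G\<^esub> g) ` P \<subseteq> Q}"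

text \<open>In the next two definitions the \<open>p\<close>-group \<open>S\<close> carrying the fusion system is a group
  record.\<close>

definition strongly_closed :: "'a monoid \<Rightarrow> 'a fusion \<Rightarrow> 'a set \<Rightarrow> bool" where
  "strongly_closed S F T \<longleftrightarrow> subgroup T S \<and>
     (\<forall>P. subgroup P (S\<lparr>carrier := T\<rparr>) \<longrightarrow> (\<forall>\<phi>\<in>F P (carrier S). \<phi> ` P \<subseteq> T))"

text \<open>Normality of \<open>T i\<close> in \<open>T (Suc i)\<close> need not be required: a fusion system on \<open>S\<close> contains
  all conjugation maps by elements of \<open>S\<close>, so its strongly closed subgroups are normal in \<open>S\<close>.\<close>

definition supersolvable_fusion :: "'a monoid \<Rightarrow> 'a fusion \<Rightarrow> bool" where
  "supersolvable_fusion S F \<longleftrightarrow>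
     (\<exists>n T. T 0 = {\<one>\<^bsub>S\<^esub>} \<and> T n = carrier S \<and>
        (\<forall>i\<le>n. strongly_closed S F (T i)) \<and>
        (\<forall>i<n. T i \<subseteq> T (Suc i) \<and> cyclic_group (S\<lparr>carrier := T (Suc i)\<rparr> Mod T i)))"

end

theory Submission
  imports Defs "HOL-Algebra.Zassenhaus" "HOL-Algebra.Sylow" "HOL-Algebra.SndIsomorphismGrp"
    "HOL-Algebra.Multiplicative_Group"
begin

text \<open>
  The proof shows that the normalizer of \<open>S\<close> controls fusion in \<open>S\<close>; essential subgroups and
  Alperin's theorem are avoided by a downward induction on the order of the subgroup \<open>P\<close> on which a
  conjugation map is defined. Up to conjugation \<open>P\<close> is fully normalized: \<open>T = N_S(P)\<close> is a Sylow
  subgroup of \<open>K = N_G(P)\<close>, and it remains to treat conjugation by elements of \<open>K\<close>. If \<open>C_S(P)\<close>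
  is not contained in \<open>P\<close>, the Frattini argument for \<open>C_K(P)\<close> lets one replace \<open>P\<close> by
  \<open>P C_S(P)\<close>. Otherwise \<open>|P| > |D|\<close>, since a subgroup of order \<open>p|D|\<close> containing \<open>P\<close> would be
  abelian and hence centralize \<open>P\<close>. Then \<open>U = O_p(K)\<close> lies in the supersolvable hypercenter of \<open>K\<close>
  and has a \<open>K\<close>-invariant chain with factors of order \<open>p\<close>. The stabilizer of such a chain is
  \<open>T C_K(U)\<close>, so \<open>K = C_K(U) N_K(T)\<close> by Frattini, and \<open>P\<close> may be replaced by \<open>T\<close>.
  Finally \<open>S = O_p(N_G(S))\<close> lies in the supersolvable hypercenter of \<open>N_G(S)\<close>, and the resulting
  chain of \<open>N_G(S)\<close>-invariant subgroups of \<open>S\<close> is strongly closed.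
\<close>

section \<open>Actions of p-groups and Sylow subgroups\<close>

context group
begin

text \<open>Together with right association by \<open>m_assoc\<close> these rules let the simplifier
  cancel adjacent inverse pairs, which settles most of the word identities for conjugates and
  commutators below.\<close>

lemma l_cancel_inv [simp]:
  assumes "x \<in> carrier G" "y \<in> carrier G"
  shows "inv x \<otimes> (x \<otimes> y) = y" "x \<otimes> (inv x \<otimes> y) = y"
  using assms by (simp_all flip: m_assoc)

text \<open>The moved points are the union of the orbits of length other than 1. Orbit lengths
  divide \<open>p ^ k\<close>, so each of these orbits has length divisible by \<open>p\<close>. The
  action is a plain function \<open>a\<close> obeying the action laws on \<open>E\<close> only, so
  that no homomorphism into \<open>BijGroup\<close> has to be built at each use.\<close>

lemma p_group_dvd_nonfixed:
  fixes p :: nat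
  assumes p: "prime p" and ord: "order G = p ^ k" and fin: "finite E"
    and cl: "\<And>g x. \<lbrakk>g \<in> carrier G; x \<in> E\<rbrakk> \<Longrightarrow> a g x \<in> E"
    and one: "\<And>x. x \<in> E \<Longrightarrow> a \<one> x = x"
    and mul: "\<And>g h x. \<lbrakk>g \<in> carrier G; h \<in> carrier G; x \<in> E\<rbrakk> \<Longrightarrow> a (g \<otimes> h) x = a g (a h x)"
  shows "p dvd card {x \<in> E. \<exists>g\<in>carrier G. a g x \<noteq> x}"
proof -
  \<comment> \<open>Members of \<open>Bij E\<close> are extensional, so \<open>a g\<close> must be
    cut down to \<open>E\<close> before it gives a \<open>group_action\<close>.\<close>
  define f where "f g = restrict (a g) E" for g
  have bij: "f g \<in> Bij E" if g: "g \<in> carrier G" for g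
  proof -
    have "a (inv g) (a g x) = x \<and> a g (a (inv g) x) = x" if "x \<in> E" for x
      using g that one mul[of "inv g" g x] mul[of g "inv g" x] by simp
    then have "bij_betw (f g) E E"
      by (intro bij_betw_byWitness[where f' = "a (inv g)"]) (use g cl in \<open>auto simp: f_def\<close>)
    then show ?thesis by (auto simp: Bij_def f_def)
  qed
  have "f \<in> hom G (BijGroup E)"
    using bij by (intro homI) (auto simp: BijGroup_def f_def compose_def fun_eq_iff mul cl)
  then interpret act: group_action G E f
    by (simp add: group_action_def group_hom_def group_hom_axioms_def group_BijGroup)
  let ?N = "{x \<in> E. \<exists>g\<in>carrier G. a g x \<noteq> x}"
  let ?C = "{B \<in> orbits G E f. card B \<noteq> 1}"
  have orb: "card (orbit G f x) = 1 \<longleftrightarrow> (\<forall>g\<in>carrier G. a g x = x)" if x: "x \<in> E" for x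
  proof
    assume "card (orbit G f x) = 1"
    then obtain y where "orbit G f x = {y}" by (auto simp: card_1_singleton_iff)
    with act.orbit_refl[OF x] have "orbit G f x = {x}" by auto
    then show "\<forall>g\<in>carrier G. a g x = x" using x by (auto simp: orbit_def f_def)
  next
    assume "\<forall>g\<in>carrier G. a g x = x"
    then have "orbit G f x = {x}" using x act.orbit_refl[OF x] by (auto simp: orbit_def f_def)
    then show "card (orbit G f x) = 1" by simp
  qed
  have "?N = \<Union>?C"
  proof (intro equalityI subsetI)
    fix x assume "x \<in> ?N"
    then have "x \<in> E" "orbit G f x \<in> ?C" using orb by (auto simp: orbits_def)
    then show "x \<in> \<Union>?C" using act.orbit_refl by blast
  next
    fix x assume "x \<in> \<Union>?C"
    then obtain B where B: "B \<in> orbits G E f" "card B \<noteq> 1" "x \<in> B" by blast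
    then have x: "x \<in> E" using act.orbits_coverture by blast
    have "orbit G f x \<in> orbits G E f" using x by (auto simp: orbits_def)
    with B act.disjoint_union act.orbit_refl[OF x] have "B = orbit G f x" by blast
    then show "x \<in> ?N" using B x orb by auto
  qed
  moreover have "p dvd card (\<Union>?C)"
  proof (rule dvd_partition)
    show "finite (\<Union>?C)" using act.orbits_coverture by (intro rev_finite_subset[OF fin]) auto
    show "\<forall>c\<in>?C. p dvd card c"
    proof
      fix B assume "B \<in> ?C"
      then have "B \<in> orbits G E f" "card B \<noteq> 1" by auto
      then obtain x where "x \<in> E" "B = orbit G f x" by (auto simp: orbits_def)
      then have "card B dvd p ^ k"
        using act.orbit_stabilizer_theorem[of x] ord by (metis dvd_triv_left)
      then obtain i where "card B = p ^ i" using p divides_primepow_nat by blast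
      with \<open>card B \<noteq> 1\<close> show "p dvd card B" by (cases i) auto
    qed
    show "\<forall>c1\<in>?C. \<forall>c2\<in>?C. c1 \<noteq> c2 \<longrightarrow> c1 \<inter> c2 = {}"
      using act.disjoint_union by blast
  qed
  ultimately show ?thesis by simp
qed

lemma p_group_fixed_point:
  fixes p :: nat
  assumes "prime p" "order G = p ^ k" "finite E"
    and "\<And>g x. \<lbrakk>g \<in> carrier G; x \<in> E\<rbrakk> \<Longrightarrow> a g x \<in> E"
    and "\<And>x. x \<in> E \<Longrightarrow> a \<one> x = x"
    and "\<And>g h x. \<lbrakk>g \<in> carrier G; h \<in> carrier G; x \<in> E\<rbrakk> \<Longrightarrow> a (g \<otimes> h) x = a g (a h x)"
    and "\<not> p dvd card E"
  shows "\<exists>x\<in>E. \<forall>g\<in>carrier G. a g x = x"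
proof -
  have "p dvd card {x \<in> E. \<exists>g\<in>carrier G. a g x \<noteq> x}"
    using assms(1-6) by (rule p_group_dvd_nonfixed)
  then have "{x \<in> E. \<exists>g\<in>carrier G. a g x \<noteq> x} \<noteq> E" using assms(7) by metis
  then show ?thesis by auto
qed

lemma p_group_dvd_fixed:
  fixes p :: nat
  assumes "prime p" "order G = p ^ k" "finite E"
    and "\<And>g x. \<lbrakk>g \<in> carrier G; x \<in> E\<rbrakk> \<Longrightarrow> a g x \<in> E"
    and "\<And>x. x \<in> E \<Longrightarrow> a \<one> x = x"
    and "\<And>g h x. \<lbrakk>g \<in> carrier G; h \<in> carrier G; x \<in> E\<rbrakk> \<Longrightarrow> a (g \<otimes> h) x = a g (a h x)"
    and "p dvd card E"
  shows "p dvd card {x \<in> E. \<forall>g\<in>carrier G. a g x = x}"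
proof -
  let ?F = "{x \<in> E. \<forall>g\<in>carrier G. a g x = x}"
  have "E - ?F = {x \<in> E. \<exists>g\<in>carrier G. a g x \<noteq> x}" by auto
  then have d: "p dvd card (E - ?F)" using p_group_dvd_nonfixed[OF assms(1-6)] by simp
  have c: "card E = card ?F + card (E - ?F)"
    using assms(3) by (subst card_Un_disjoint[symmetric]) (auto intro: arg_cong[where f = card])
  show ?thesis using assms(7) unfolding c dvd_add_left_iff[OF d] .
qed

text \<open>Conjugation is injective, so on a finite \<open>H\<close> one inclusion already forces
  equality. This also reconciles \<open>inv g \<otimes> h \<otimes> g\<close> with the opposite side
  convention in the definition of \<open>normalizer\<close>.\<close>

lemma mem_normalizer_iff:
  assumes "finite H" "H \<subseteq> carrier G"
  shows "g \<in> normalizer G H \<longleftrightarrow> g \<in> carrier G \<and> (\<forall>h\<in>H. inv g \<otimes> h \<otimes> g \<in> H)"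
proof -
  have conj: "inv g <# H #> g = (\<lambda>h. inv g \<otimes> h \<otimes> g) ` H"
    and conj': "g <# H #> inv g = (\<lambda>h. g \<otimes> h \<otimes> inv g) ` H" if "g \<in> carrier G"
    by (auto simp: l_coset_def r_coset_def)
  have "g <# H #> inv g = H \<longleftrightarrow> (\<lambda>h. inv g \<otimes> h \<otimes> g) ` H \<subseteq> H" if g: "g \<in> carrier G"
  proof
    assume *: "g <# H #> inv g = H"
    show "(\<lambda>h. inv g \<otimes> h \<otimes> g) ` H \<subseteq> H"
    proof safe
      fix h assume "h \<in> H"
      then obtain h' where "h' \<in> H" "h = g \<otimes> h' \<otimes> inv g"
        using * conj'[OF g] by blast
      then show "inv g \<otimes> h \<otimes> g \<in> H" using g assms by (simp add: m_assoc subset_iff)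
    qed
  next
    assume *: "(\<lambda>h. inv g \<otimes> h \<otimes> g) ` H \<subseteq> H"
    have "inj_on (\<lambda>h. inv g \<otimes> h \<otimes> g) H"
      using g assms by (auto simp: inj_on_def subset_iff)
    then have "(\<lambda>h. inv g \<otimes> h \<otimes> g) ` H = H"
      using * assms(1) by (simp add: card_image card_subset_eq)
    moreover have "(\<lambda>h. g \<otimes> h \<otimes> inv g) ` (\<lambda>h. inv g \<otimes> h \<otimes> g) ` H = H"
      using g assms by (force simp: image_image m_assoc subset_iff)
    ultimately show "g <# H #> inv g = H" using conj'[OF g] by metis
  qed
  then show ?thesis using assms by (auto simp: normalizer_def stabilizer_def)
qed

end

text \<open>Divisibility of the group order by \<open>p\<close> is left out, so that every subgroup
  satisfies the locale again; the proofs interpret it for normalizers, stabilizers and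
  centralizers.\<close>

locale finite_group_prime = group G for G :: "'a monoid" (structure) and p :: nat +
  assumes finite_carrier [simp]: "finite (carrier G)" and prime [simp]: "prime p"
begin

lemma finite_subgroup: "subgroup H G \<Longrightarrow> finite H"
  using finite_carrier finite_subset subgroup.subset by blast

lemma subgroup_finite_group_prime:
  "subgroup H G \<Longrightarrow> finite_group_prime (G\<lparr>carrier := H\<rparr>) p"
  by (simp add: finite_group_prime_def finite_group_prime_axioms_def subgroup_imp_group finite_subgroup)

text \<open>Trades the multiplicity for a factorization of the order into a power of
  \<open>p\<close> and a factor prime to \<open>p\<close>, the form in which indices are compared
  below.\<close>

lemma sylow_subgroup_iff:
  "sylow_subgroup G p S \<longleftrightarrow> subgroup S G \<and>
    (\<exists>n m. card S = p ^ n \<and> order G = p ^ n * m \<and> \<not> p dvd m)"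
proof -
  have o: "order G \<noteq> 0" using order_gt_0_iff_finite by simp
  have "(\<exists>n m. card S = p ^ n \<and> order G = p ^ n * m \<and> \<not> p dvd m) \<longleftrightarrow> card S = p ^ multiplicity p (order G)"
  proof safe
    fix n m assume *: "card S = p ^ n" "order G = p ^ n * m" "\<not> p dvd m"
    have "multiplicity p (order G) = n"
      using * by (intro multiplicity_eqI) (simp_all add: prime_gt_0_nat)
    then show "card S = p ^ multiplicity p (order G)" using * by simp
  next
    assume "card S = p ^ multiplicity p (order G)"
    moreover obtain m where "order G = p ^ multiplicity p (order G) * m" "\<not> p dvd m"
      using multiplicity_decompose'[OF o, of p] prime by (metis not_prime_unit)
    ultimately show "\<exists>n m. card S = p ^ n \<and> order G = p ^ n * m \<and> \<not> p dvd m" by blast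
  qed
  then show ?thesis by (auto simp: sylow_subgroup_def)
qed

lemma sylow_subgroup_exists:
  obtains S where "sylow_subgroup G p S"
proof -
  obtain m where "order G = p ^ multiplicity p (order G) * m"
    using multiplicity_dvd by blast
  then show ?thesis
    using sylow_thm[OF prime group_axioms _ finite_carrier] that by (auto simp: sylow_subgroup_def)
qed

section \<open>Conjugation into Sylow subgroups and growth of normalizers, by actions on
  cosets\<close>

lemma finite_rcosets: "finite (rcosets H)"
  by (simp add: RCOSETS_def)

text \<open>The inverse turns right multiplication of cosets into a left action, as the fixed point
  lemmas require.\<close>

lemma rcosets_act:
  assumes "subgroup H G" "A \<in> rcosets H"
  shows "g \<in> carrier G \<Longrightarrow> A #> inv g \<in> rcosets H" "A #> inv \<one> = A"
    "\<lbrakk>g \<in> carrier G; h \<in> carrier G\<rbrakk> \<Longrightarrow> A #> inv (g \<otimes> h) = A #> inv h #> inv g"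
proof -
  have A: "A \<subseteq> carrier G" using assms by (simp add: subgroup.rcosets_carrier)
  obtain y where "y \<in> carrier G" "A = H #> y" using assms by (auto simp: RCOSETS_def)
  then show "g \<in> carrier G \<Longrightarrow> A #> inv g \<in> rcosets H"
    using assms by (simp add: coset_mult_assoc subgroup.subset rcosetsI)
  show "A #> inv \<one> = A" "\<lbrakk>g \<in> carrier G; h \<in> carrier G\<rbrakk> \<Longrightarrow> A #> inv (g \<otimes> h) = A #> inv h #> inv g"
    using A assms by (simp_all add: coset_mult_assoc inv_mult_group)
qed

text \<open>\<open>Q\<close> acts on the right cosets of \<open>S\<close>. Their number is prime to
  \<open>p\<close>, so some coset \<open>S #> y\<close> is fixed, which means that
  \<open>y \<otimes> x \<otimes> inv y\<close> lies in \<open>S\<close> for all \<open>x\<close> in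
  \<open>Q\<close>.\<close>

lemma sylow_contains_conjugate:
  assumes S: "sylow_subgroup G p S"
    and Q: "subgroup Q G" "card Q = p ^ k"
  obtains g where "g \<in> carrier G" "\<And>x. x \<in> Q \<Longrightarrow> inv g \<otimes> x \<otimes> g \<in> S"
proof -
  interpret Q: group "G\<lparr>carrier := Q\<rparr>" using Q(1) by (rule subgroup_imp_group)
  obtain n m where nm: "subgroup S G" "card S = p ^ n" "order G = p ^ n * m" "\<not> p dvd m"
    using S sylow_subgroup_iff by blast
  have "card (rcosets S) * card S = order G" using nm lagrange by blast
  then have m: "card (rcosets S) = m" using nm prime_gt_0_nat[OF prime] by simp
  have Qc: "\<And>x. x \<in> Q \<Longrightarrow> x \<in> carrier G" using subgroup.mem_carrier[OF Q(1)] .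
  have "\<exists>A\<in>rcosets S. \<forall>x\<in>carrier (G\<lparr>carrier := Q\<rparr>). A #> inv x = A"
  proof (rule Q.p_group_fixed_point[OF prime, of k "rcosets S" "\<lambda>x A. A #> inv x"])
    show "order (G\<lparr>carrier := Q\<rparr>) = p ^ k" using Q by (simp add: order_def)
    show "finite (rcosets S)" by (rule finite_rcosets)
    show "\<not> p dvd card (rcosets S)" using m nm by simp
    show "A #> inv x \<in> rcosets S" if "x \<in> carrier (G\<lparr>carrier := Q\<rparr>)" "A \<in> rcosets S" for x A
      using that by (intro rcosets_act[OF nm(1)] Qc) simp_all
    show "A #> inv \<one>\<^bsub>G\<lparr>carrier := Q\<rparr>\<^esub> = A" if "A \<in> rcosets S" for A
      using rcosets_act(2)[OF nm(1) that] by simp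
    show "A #> inv (x \<otimes>\<^bsub>G\<lparr>carrier := Q\<rparr>\<^esub> y) = A #> inv y #> inv x"
      if "x \<in> carrier (G\<lparr>carrier := Q\<rparr>)" "y \<in> carrier (G\<lparr>carrier := Q\<rparr>)" "A \<in> rcosets S" for x y A
      using rcosets_act(3)[OF nm(1) that(3), of x y] that Qc by simp
  qed
  then obtain A where A: "A \<in> rcosets S" "\<And>x. x \<in> Q \<Longrightarrow> A #> inv x = A" by auto
  then obtain y where y: "y \<in> carrier G" "A = S #> y" by (auto simp: RCOSETS_def)
  have "y \<otimes> x \<otimes> inv y \<in> S" if x: "x \<in> Q" for x
  proof -
    have "S #> (y \<otimes> inv x) = S #> y"
      using A(2)[OF x] y Qc[OF x] nm by (simp add: coset_mult_assoc subgroup.subset)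
    then have "y \<in> S #> (y \<otimes> inv x)" using y nm rcos_self by auto
    then obtain s where "s \<in> S" "y = s \<otimes> (y \<otimes> inv x)" by (auto simp: r_coset_def)
    then have "y \<otimes> x \<otimes> inv y = s" using y Qc[OF x] subgroup.mem_carrier[OF nm(1)]
      by (metis inv_closed inv_solve_right' m_assoc m_closed inv_inv)
    then show ?thesis using \<open>s \<in> S\<close> by simp
  qed
  then show ?thesis using that[of "inv y"] y by simp
qed

text \<open>\<open>P\<close> acts on its own right cosets, whose number is a nontrivial power of
  \<open>p\<close>. The number of fixed cosets is divisible by \<open>p\<close> and \<open>P\<close>
  is one of them, so there is a second; its representatives normalize \<open>P\<close>.\<close>

lemma p_group_normalizer_grows:
  assumes ord: "order G = p ^ k" and P: "subgroup P G" "P \<noteq> carrier G"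
  shows "\<exists>g\<in>carrier G - P. \<forall>x\<in>P. inv g \<otimes> x \<otimes> g \<in> P"
proof -
  interpret P: group "G\<lparr>carrier := P\<rparr>" using P(1) by (rule subgroup_imp_group)
  have Pc: "\<And>x. x \<in> P \<Longrightarrow> x \<in> carrier G" using subgroup.mem_carrier[OF P(1)] .
  have L: "card (rcosets P) * card P = p ^ k" using P lagrange ord by simp
  then obtain j where j: "card P = p ^ j" using prime by (metis dvd_triv_right divides_primepow_nat)
  obtain i where i: "card (rcosets P) = p ^ i" using prime L by (metis dvd_triv_left divides_primepow_nat)
  have "i \<noteq> 0"
  proof
    assume "i = 0"
    then have "card P = order G" using i L ord by simp
    then show False using P finite_carrier by (metis card_subset_eq order_def subgroup.subset)
  qed
  let ?F = "{A \<in> rcosets P. \<forall>x\<in>P. A #> inv x = A}"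
  have "p dvd card {A \<in> rcosets P. \<forall>x\<in>carrier (G\<lparr>carrier := P\<rparr>). A #> inv x = A}"
  proof (rule P.p_group_dvd_fixed[OF prime, of j "rcosets P" "\<lambda>x A. A #> inv x"])
    show "order (G\<lparr>carrier := P\<rparr>) = p ^ j" using j by (simp add: order_def)
    show "finite (rcosets P)" by (rule finite_rcosets)
    show "p dvd card (rcosets P)" using i \<open>i \<noteq> 0\<close> by simp
    show "A #> inv x \<in> rcosets P" if "x \<in> carrier (G\<lparr>carrier := P\<rparr>)" "A \<in> rcosets P" for x A
      using that by (intro rcosets_act[OF P(1)] Pc) simp_all
    show "A #> inv \<one>\<^bsub>G\<lparr>carrier := P\<rparr>\<^esub> = A" if "A \<in> rcosets P" for A
      using rcosets_act(2)[OF P(1) that] by simp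
    show "A #> inv (x \<otimes>\<^bsub>G\<lparr>carrier := P\<rparr>\<^esub> y) = A #> inv y #> inv x"
      if "x \<in> carrier (G\<lparr>carrier := P\<rparr>)" "y \<in> carrier (G\<lparr>carrier := P\<rparr>)" "A \<in> rcosets P" for x y A
      using rcosets_act(3)[OF P(1) that(3), of x y] that Pc by simp
  qed
  then have d: "p dvd card ?F" by simp
  have PF: "P \<in> ?F" using P by (auto simp: subgroup.subgroup_in_rcosets subgroup.rcos_const subgroup.m_inv_closed)
  have "?F \<noteq> {P}" using d prime by (metis is_singletonI is_singleton_altdef nat_dvd_1_iff_1 not_prime_1)
  then obtain A where A: "A \<in> rcosets P" "\<And>x. x \<in> P \<Longrightarrow> A #> inv x = A" "A \<noteq> P" using PF by blast
  then obtain y where y: "y \<in> carrier G" "A = P #> y" by (auto simp: RCOSETS_def)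
  have "y \<otimes> x \<otimes> inv y \<in> P" if x: "x \<in> P" for x
  proof -
    have "P #> (y \<otimes> inv x) = P #> y"
      using A(2)[OF x] y Pc[OF x] P by (simp add: coset_mult_assoc subgroup.subset)
    then have "y \<in> P #> (y \<otimes> inv x)" using y P rcos_self by auto
    then obtain s where "s \<in> P" "y = s \<otimes> (y \<otimes> inv x)" by (auto simp: r_coset_def)
    then have "y \<otimes> x \<otimes> inv y = s" using y Pc[OF x] Pc[of s]
      by (metis inv_closed inv_solve_right' m_assoc m_closed inv_inv)
    then show ?thesis using \<open>s \<in> P\<close> by simp
  qed
  moreover have "inv y \<notin> P"
    using A(3) y P by (metis coset_join2 inv_inv subgroup.m_inv_closed)
  ultimately show ?thesis using y by (intro bexI[of _ "inv y"]) auto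
qed

text \<open>By the second isomorphism theorem \<open>N\<close> has as many cosets in
  \<open>N <#> H\<close> as \<open>N \<inter> H\<close> has in \<open>H\<close>; Lagrange turns this
  into orders.\<close>

lemma card_set_mult_normal:
  assumes "N \<lhd> G" "subgroup H G"
  shows "card (N <#> H) * card (N \<inter> H) = card N * card H"
proof -
  interpret second_isomorphism_grp N G H
    using assms by (simp add: second_isomorphism_grp_def second_isomorphism_grp_axioms_def)
  have sNH: "subgroup (N <#> H) G" by (rule normal_set_mult_subgroup)
  have "card (rcosets\<^bsub>G\<lparr>carrier := N <#> H\<rparr>\<^esub> N) = card (rcosets\<^bsub>G\<lparr>carrier := H\<rparr>\<^esub> (N \<inter> H))"
    using iso_same_order[OF normal_intersection_quotient_isom]
    by (simp add: order_def FactGroup_def)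
  moreover have "card (rcosets\<^bsub>G\<lparr>carrier := N <#> H\<rparr>\<^esub> N) * card N = card (N <#> H)"
    using group.lagrange[OF subgroup_imp_group[OF sNH], of N] sNH H_contained_in_set_mult
    by (simp add: order_def subgroup_incl normal_imp_subgroup[OF assms(1)])
  moreover have "card (rcosets\<^bsub>G\<lparr>carrier := H\<rparr>\<^esub> (N \<inter> H)) * card (N \<inter> H) = card H"
    using group.lagrange[OF subgroup_imp_group[OF assms(2)], of "N \<inter> H"] assms
    by (simp add: order_def subgroup_incl normal_imp_subgroup subgroups_Inter_pair)
  moreover have "nh * i = n * h" if "r = s" "r * n = nh" "s * i = h" for nh i n h r s :: nat
    using that by auto
  ultimately show ?thesis by blast
qed

section \<open>Extending subgroups of a \<open>p\<close>-group\<close>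

lemma card_subgroup_dvd:
  assumes "subgroup H G" "subgroup K G" "H \<subseteq> K"
  shows "card H dvd card K"
  using group.lagrange[OF subgroup_imp_group[OF assms(2)] subgroup_incl[OF assms]]
  unfolding order_def by (auto intro: dvdI[OF trans[OF sym mult.commute]])

lemma card_subgroup_pos: "subgroup H G \<Longrightarrow> 0 < card H"
  by (simp add: subgroup.finite_imp_card_positive)

lemma p_group_subgroup_card:
  assumes "subgroup H G" "subgroup K G" "H \<subseteq> K" "card K = p ^ k"
  obtains j where "card H = p ^ j"
  using card_subgroup_dvd[OF assms(1-3)] assms(4) divides_primepow_nat[OF prime] by auto

lemma subgroup_normalizer: "subgroup H G \<Longrightarrow> subgroup (normalizer G H) G"
  by (simp add: normalizer_imp_subgroup subgroup.subset)

lemma subgroup_subset_normalizer: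
  assumes "subgroup H G"
  shows "H \<subseteq> normalizer G H"
  using assms by (auto simp: mem_normalizer_iff finite_subgroup subgroup.subset subgroup.mem_carrier
      subgroup.m_closed subgroup.m_inv_closed)

text \<open>The normalizer of \<open>P\<close> is strictly larger than \<open>P\<close>, so its
  quotient by \<open>P\<close> has a subgroup \<open>A\<close> of order \<open>p\<close>. The
  preimage of \<open>A\<close> is \<open>\<Union>A\<close>.\<close>

lemma p_group_subgroup_extend:
  assumes ord: "order G = p ^ k" and P: "subgroup P G" "P \<noteq> carrier G"
  shows "\<exists>B. subgroup B G \<and> P \<subseteq> B \<and> card B = p * card P"
proof -
  let ?N = "G\<lparr>carrier := normalizer G P\<rparr>"
  have N: "subgroup (normalizer G P) G" using P(1) by (rule subgroup_normalizer)
  obtain g where "g \<in> normalizer G P" "g \<notin> P"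
    using p_group_normalizer_grows[OF assms] P
    by (auto simp: mem_normalizer_iff finite_subgroup subgroup.subset)
  then have lt: "card P < card (normalizer G P)"
    using subgroup_subset_normalizer[OF P(1)] finite_subgroup[OF N]
    by (metis psubsetI psubset_card_mono)
  interpret P: normal P ?N using P(1) by (rule subgroup_in_normalizer)
  have L: "card (rcosets\<^bsub>?N\<^esub> P) * card P = card (normalizer G P)"
    using P.lagrange[OF P.subgroup_axioms] by (simp add: order_def)
  obtain j where "card (normalizer G P) = p ^ j"
    using p_group_subgroup_card[OF N subgroup_self] N ord by (auto simp: order_def subgroup.subset)
  with L obtain i where i: "card (rcosets\<^bsub>?N\<^esub> P) = p ^ i"
    using divides_primepow_nat[OF prime] by (metis dvd_triv_left)
  have "i \<noteq> 0" using i L lt by (cases i) simp_all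
  then obtain i' where "i = Suc i'" by (cases i) auto
  then have "order (?N Mod P) = p ^ 1 * p ^ i'" using i by (simp add: order_def FactGroup_def)
  moreover have "finite (carrier (?N Mod P))"
    using N by (simp add: FactGroup_def RCOSETS_def finite_subgroup)
  ultimately obtain A where A: "subgroup A (?N Mod P)" "card A = p"
    using sylow_thm[OF prime P.factorgroup_is_group, of 1] by auto
  have B: "subgroup (\<Union>A) ?N" using P.factgroup_subgroup_union_subgroup[OF A(1)] .
  then have BG: "subgroup (\<Union>A) G" using N incl_subgroup by blast
  have PA: "P \<in> A" using subgroup.one_closed[OF A(1)] by simp
  then have PB: "P \<subseteq> \<Union>A" by blast
  have "A = rcosets\<^bsub>G\<lparr>carrier := \<Union>A\<rparr>\<^esub> P" using P.factgroup_subgroup_union_factor[OF A(1)] by simp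
  then have "card (\<Union>A) = p * card P"
    using group.lagrange[OF subgroup_imp_group[OF BG] subgroup_incl[OF P(1) BG PB]] A(2)
    by (simp add: order_def)
  then show ?thesis using BG PB by blast
qed

lemma p_subgroup_extend:
  assumes S: "subgroup S G" "card S = p ^ k" and P: "subgroup P G" "P \<subset> S"
  obtains B where "subgroup B G" "P \<subseteq> B" "B \<subseteq> S" "card B = p * card P"
proof -
  interpret S: finite_group_prime "G\<lparr>carrier := S\<rparr>" p
    using S(1) by (rule subgroup_finite_group_prime)
  have "subgroup P (G\<lparr>carrier := S\<rparr>)" using P S by (intro subgroup_incl) auto
  then obtain B where "subgroup B (G\<lparr>carrier := S\<rparr>)" "P \<subseteq> B" "card B = p * card P"
    using S.p_group_subgroup_extend[of k P] P S by (auto simp: order_def)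
  then show ?thesis using that incl_subgroup[OF S(1)] subgroup.subset by fastforce
qed

text \<open>Iterates the extension by a factor \<open>p\<close>. The target \<open>p * d\<close>
  exceeds the bound \<open>d\<close> on \<open>card P\<close>, so at least one extension takes
  place, and \<open>d < card S\<close> guarantees room for it.\<close>

lemma p_subgroup_extend_to_card:
  assumes S: "subgroup S G" "card S = p ^ k" and d: "d = p ^ a" "d < card S"
  shows "\<lbrakk>subgroup P G; P \<subseteq> S; card P \<le> d\<rbrakk> \<Longrightarrow>
    \<exists>B. subgroup B G \<and> P \<subseteq> B \<and> B \<subseteq> S \<and> card B = p * d"
proof (induction "d - card P" arbitrary: P rule: less_induct)
  case less
  have "P \<subset> S" using less d by auto
  then obtain B where B: "subgroup B G" "P \<subseteq> B" "B \<subseteq> S" "card B = p * card P"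
    using p_subgroup_extend[OF S less.prems(1)] by blast
  show ?case
  proof (cases "card P = d")
    case True then show ?thesis using B by blast
  next
    case False
    obtain j where j: "card P = p ^ j"
      using p_group_subgroup_card[OF less.prems(1) S(1) less.prems(2) S(2)] .
    \<comment> \<open>All orders are powers of \<open>p\<close>, so one extension of a subgroup of
      order below \<open>d\<close> cannot overshoot \<open>d\<close>.\<close>
    have "j < a" using False less.prems(3) j d prime_gt_1_nat[OF prime]
      by (metis nat_less_le power_less_imp_less_exp)
    then have "p ^ Suc j \<le> p ^ a"
      using prime_gt_0_nat[OF prime] by (intro power_increasing) auto
    then have "card B \<le> d" using B j d by simp
    moreover have "card P < card B"
      using B(4) card_subgroup_pos[OF less.prems(1)] prime_gt_1_nat[OF prime] by simp
    ultimately show ?thesis using less.hyps[of B] B by (metis diff_less_mono2 less_le_trans subset_trans)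
  qed
qed

text \<open>The index \<open>m'\<close> of \<open>A \<inter> T\<close> in \<open>A\<close> equals
  that of \<open>T\<close> in \<open>A <#> T\<close>. It therefore divides the index of
  \<open>T\<close> in the whole group and is prime to \<open>p\<close>.\<close>

lemma sylow_Int_normal:
  assumes T: "sylow_subgroup G p T" and A: "A \<lhd> G"
  shows "sylow_subgroup (G\<lparr>carrier := A\<rparr>) p (A \<inter> T)"
proof -
  have sA: "subgroup A G" using A normal_imp_subgroup by blast
  interpret A: finite_group_prime "G\<lparr>carrier := A\<rparr>" p
    using sA by (rule subgroup_finite_group_prime)
  obtain n m where T': "subgroup T G" "card T = p ^ n" "order G = p ^ n * m" "\<not> p dvd m"
    using T sylow_subgroup_iff by blast
  have sAT: "subgroup (A \<inter> T) G" using sA T'(1) by (rule subgroups_Inter_pair)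
  obtain j where j: "card (A \<inter> T) = p ^ j"
    using p_group_subgroup_card[OF sAT T'(1) _ T'(2)] by blast
  obtain m' where m': "card A = p ^ j * m'"
    using card_subgroup_dvd[OF sAT sA] j by (auto simp: dvd_def)
  have sM: "subgroup (A <#> T) G" using A T'(1) mult_norm_subgroup by blast
  then have "card (A <#> T) dvd order G"
    using card_subgroup_dvd[OF sM subgroup_self] by (simp add: order_def subgroup.subset)
  moreover have "card (A <#> T) = m' * p ^ n"
    using card_set_mult_normal[OF A T'(1)] j m' T'(2) prime_gt_0_nat[OF prime] by simp
  ultimately have "m' dvd m" using T'(3) prime_gt_0_nat[OF prime] by (simp add: mult.commute)
  then have "\<not> p dvd m'" using T'(4) dvd_trans by blast
  then show ?thesis unfolding A.sylow_subgroup_iff using j m' sAT sA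
    by (auto simp: order_def intro: subgroup_incl)
qed

text \<open>By normality the conjugate of \<open>T\<close> by \<open>x\<close> stays in
  \<open>A\<close>, and Sylow's theorem inside \<open>A\<close> brings it back to \<open>T\<close>
  by some \<open>a\<close> in \<open>A\<close>. Then \<open>inv x \<otimes> a\<close> normalizes
  \<open>T\<close>, and its inverse is the second factor.\<close>

lemma frattini:
  assumes A: "A \<lhd> G" and T: "sylow_subgroup (G\<lparr>carrier := A\<rparr>) p T" and x: "x \<in> carrier G"
  obtains a n where "a \<in> A" "n \<in> normalizer G T" "x = a \<otimes> n"
proof -
  have sA: "subgroup A G" using A normal_imp_subgroup by blast
  interpret A: finite_group_prime "G\<lparr>carrier := A\<rparr>" p
    using sA by (rule subgroup_finite_group_prime)
  have TA: "subgroup T (G\<lparr>carrier := A\<rparr>)" using T by (simp add: sylow_subgroup_def)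
  have T': "subgroup T G" "T \<subseteq> A" using incl_subgroup[OF sA TA] subgroup.subset[OF TA] by simp_all
  have Tc: "\<And>t. t \<in> T \<Longrightarrow> t \<in> carrier G" using subgroup.mem_carrier[OF T'(1)] .
  obtain k where k: "card T = p ^ k" using T by (auto simp: sylow_subgroup_def)
  let ?Q = "x <# T #> inv x"
  have Q: "?Q = (\<lambda>t. x \<otimes> t \<otimes> inv x) ` T" by (auto simp: l_coset_def r_coset_def)
  have QA: "?Q \<subseteq> A" using T'(2) x normal.inv_op_closed2[OF A] by (auto simp: Q)
  have "subgroup ?Q G" using T'(1) x by (intro subgroup_conjugation_is_surj2)
  then have sQ: "subgroup ?Q (G\<lparr>carrier := A\<rparr>)" using QA sA by (intro subgroup_incl)
  have "inj_on (\<lambda>t. x \<otimes> t \<otimes> inv x) T" using x Tc by (auto simp: inj_on_def)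
  then have "card ?Q = p ^ k" by (simp add: Q card_image k)
  then obtain a where a: "a \<in> A" "\<And>y. y \<in> ?Q \<Longrightarrow> inv a \<otimes> y \<otimes> a \<in> T"
    using A.sylow_contains_conjugate[OF T sQ] sA by (auto simp: m_inv_consistent)
  have ac: "a \<in> carrier G" using subgroup.mem_carrier[OF sA a(1)] .
  have "inv a \<otimes> x \<in> carrier G" using ac x by simp
  moreover have "inv (inv x \<otimes> a) \<otimes> t \<otimes> (inv x \<otimes> a) \<in> T" if "t \<in> T" for t
    using a(2)[unfolded Q, OF imageI[OF that]] x ac Tc[OF that] by (simp add: inv_mult_group m_assoc)
  ultimately have "inv x \<otimes> a \<in> normalizer G T"
    using T'(1) x ac by (simp add: mem_normalizer_iff finite_subgroup subgroup.subset)
  then have "inv (inv x \<otimes> a) \<in> normalizer G T"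
    by (rule subgroup.m_inv_closed[OF subgroup_normalizer[OF T'(1)]])
  moreover have "x = a \<otimes> inv (inv x \<otimes> a)" using x ac by (simp add: inv_mult_group)
  ultimately show ?thesis using that a(1) by blast
qed

end

section \<open>Chains of normal subgroups with prime indices\<close>

text \<open>Only the top of the chain is recorded. The predicate stands in for lying below the
  supersolvable hypercenter: by \<open>prime_chain_iff\<close> it holds exactly for normal subgroups
  all of whose chief factors below have prime order and are cyclic. Rule induction replaces
  arguments about chief series. The primes may vary along the chain.\<close>

inductive prime_chain :: "'a monoid \<Rightarrow> 'a set \<Rightarrow> bool" for G where
  one: "prime_chain G {\<one>\<^bsub>G\<^esub>}"
| step: "\<lbrakk>prime_chain G N; M \<lhd> G; N \<subseteq> M; prime (q::nat); card M = q * card N\<rbrakk> \<Longrightarrow> prime_chain G M"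

context finite_group_prime
begin

lemma prime_chain_normal: "prime_chain G N \<Longrightarrow> N \<lhd> G"
  by (induction rule: prime_chain.induct) (auto simp: one_is_normal)

lemma chief_factor_order:
  assumes "chief_factor G H K"
  shows "card H = order (G\<lparr>carrier := H\<rparr> Mod K) * card K"
proof -
  have "H \<lhd> G" "K \<lhd> G" "K \<subseteq> H" using assms by (auto simp: chief_factor_def)
  then show ?thesis
    using group.lagrange[OF subgroup_imp_group subgroup_incl, of H K]
    by (simp add: normal_imp_subgroup order_def FactGroup_def)
qed

lemma prime_order_imp_cyclic_group:
  assumes "prime (order G)"
  shows "cyclic_group G"
proof -
  have "carrier G \<noteq> {\<one>}" using assms by (auto simp: order_def)
  then obtain x where x: "x \<in> carrier G" "x \<noteq> \<one>" by blast
  have s: "subgroup (generate G {x}) G" using x by (intro generate_is_subgroup) auto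
  then have "card (generate G {x}) dvd order G"
    using card_subgroup_dvd[OF s subgroup_self] by (simp add: order_def subgroup.subset)
  moreover have "card (generate G {x}) \<noteq> 1"
  proof
    assume "card (generate G {x}) = 1"
    then obtain y where "generate G {x} = {y}" by (auto simp: card_1_singleton_iff)
    moreover have "x \<in> generate G {x}" "\<one> \<in> generate G {x}" by (auto intro: generate.incl generate.one)
    ultimately show False using x by auto
  qed
  ultimately have "card (generate G {x}) = card (carrier G)"
    using assms by (auto simp: prime_nat_iff order_def)
  then have "generate G {x} = carrier G"
    using s by (simp add: card_subset_eq subgroup.subset)
  then have "subgroup_generated G {x} = G" using x by (simp add: subgroup_generated_def)
  then show ?thesis using x by (auto simp: cyclic_group_def)
qed

lemma cyclic_FactGroup_of_prime_index:
  assumes "subgroup H G" "K \<lhd> G" "K \<subseteq> H" "card H = q * card K" "prime q"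
  shows "cyclic_group (G\<lparr>carrier := H\<rparr> Mod K)" "order (G\<lparr>carrier := H\<rparr> Mod K) = q"
proof -
  have K: "K \<lhd> G\<lparr>carrier := H\<rparr>" using assms normal_restrict_supergroup by blast
  have "card H = order (G\<lparr>carrier := H\<rparr> Mod K) * card K"
    using group.lagrange[OF subgroup_imp_group[OF assms(1)] normal_imp_subgroup[OF K]]
    by (simp add: order_def FactGroup_def)
  then show o: "order (G\<lparr>carrier := H\<rparr> Mod K) = q"
    using assms(4) card_subgroup_pos[OF normal_imp_subgroup[OF assms(2)]] by simp
  then have "finite (carrier (G\<lparr>carrier := H\<rparr> Mod K))"
    using assms(5) by (metis card.infinite not_prime_0 order_def)
  then interpret Q: finite_group_prime "G\<lparr>carrier := H\<rparr> Mod K" p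
    using normal.factorgroup_is_group[OF K]
    by (simp add: finite_group_prime_def finite_group_prime_axioms_def)
  show "cyclic_group (G\<lparr>carrier := H\<rparr> Mod K)"
    using o assms(5) by (intro Q.prime_order_imp_cyclic_group) simp
qed

text \<open>Compare the product formula of \<open>card_set_mult_normal\<close> for \<open>H\<close>
  with the one for \<open>K\<close>. For prime \<open>q\<close> it follows that a step of a chain
  survives either in the product with \<open>N\<close> or in the intersection with \<open>N\<close>,
  but not in both.\<close>

lemma index_set_mult_Int:
  assumes N: "N \<lhd> G" and HK: "subgroup K G" "subgroup H G" "K \<subseteq> H" "card H = q * card K"
  obtains d e where "q = d * e" "card (N <#> H) = d * card (N <#> K)" "card (N \<inter> H) = e * card (N \<inter> K)"
proof -
  have sN: "subgroup N G" using N normal_imp_subgroup by blast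
  have sNK: "subgroup (N \<inter> K) G" and sNH: "subgroup (N \<inter> H) G"
    using sN HK by (auto intro: subgroups_Inter_pair)
  obtain e where e: "card (N \<inter> H) = card (N \<inter> K) * e"
    using card_subgroup_dvd[OF sNK sNH] HK(3) by (auto simp: dvd_def)
  have NK: "subgroup (N <#> K) G" using N HK(1) by (rule mult_norm_subgroup)
  moreover have "subgroup (N <#> H) G" using N HK(2) by (rule mult_norm_subgroup)
  moreover have "N <#> K \<subseteq> N <#> H" using HK(3) by (intro mono_set_mult) auto
  ultimately have "card (N <#> K) dvd card (N <#> H)" by (rule card_subgroup_dvd)
  then obtain d where d: "card (N <#> H) = card (N <#> K) * d" by (auto simp: dvd_def)
  have "card (N <#> K) * d * (card (N \<inter> K) * e) = card N * (q * card K)"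
    using card_set_mult_normal[OF N HK(2)] by (simp add: d e HK(4))
  also have "\<dots> = q * (card (N <#> K) * card (N \<inter> K))"
    using card_set_mult_normal[OF N HK(1)] by simp
  finally have "(d * e) * (card (N <#> K) * card (N \<inter> K)) = q * (card (N <#> K) * card (N \<inter> K))"
    by (simp add: mult_ac)
  moreover have "card (N <#> K) \<noteq> 0" "card (N \<inter> K) \<noteq> 0"
    using card_subgroup_pos[OF NK] card_subgroup_pos[OF sNK] by simp_all
  ultimately have "d * e = q" by simp
  then show ?thesis using that[of d e] d e by (simp add: mult.commute)
qed

text \<open>Multiply every member of the chain of \<open>M\<close> by \<open>N\<close>: each step
  either collapses or keeps its prime index. Closure under products is what makes a greatest such
  subgroup exist.\<close>

lemma prime_chain_set_mult:
  assumes "prime_chain G N" "prime_chain G M"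
  shows "prime_chain G (N <#> M)"
  using assms(2)
proof (induction rule: prime_chain.induct)
  case one
  have "N <#> {\<one>} = N"
    using prime_chain_normal[OF assms(1)] normal_imp_subgroup
    by (force simp: set_mult_def dest: subgroup.mem_carrier)
  then show ?case using assms(1) by simp
next
  case (step M M' q)
  have N: "N \<lhd> G" using assms(1) by (rule prime_chain_normal)
  have M: "subgroup M G" using prime_chain_normal[OF step.hyps(1)] by (rule normal_imp_subgroup)
  have M': "subgroup M' G" using step.hyps(2) by (rule normal_imp_subgroup)
  obtain d e where de: "q = d * e" "card (N <#> M') = d * card (N <#> M)"
    using index_set_mult_Int[OF N M M' step.hyps(3,5)] .
  have sub: "N <#> M \<subseteq> N <#> M'" using step.hyps(3) by (intro mono_set_mult) auto
  have nor: "N <#> M' \<lhd> G" using N step.hyps(2) by (rule normal_subgroup_set_mult_closed)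
  have "d dvd q" using de(1) by simp
  then have "d = 1 \<or> d = q" using step.hyps(4) prime_nat_iff by blast
  then show ?case
  proof
    assume "d = 1"
    then have "N <#> M' = N <#> M"
      using de(2) sub finite_subgroup[OF normal_imp_subgroup[OF nor]] by (metis card_subset_eq mult_1)
    then show ?thesis using step.IH by simp
  next
    assume "d = q"
    then show ?thesis using prime_chain.step[OF step.IH nor sub step.hyps(4)] de(2) by simp
  qed
qed

text \<open>Consider the step from \<open>N\<close> to \<open>M\<close> at which
  \<open>H \<inter> M\<close> first leaves \<open>K\<close>. As there is no normal subgroup strictly
  between, \<open>K <#> (H \<inter> M) = H\<close>, so the index of \<open>K\<close> in
  \<open>H\<close> is that of \<open>K \<inter> (H \<inter> M)\<close> in
  \<open>H \<inter> M\<close>. The former contains \<open>H \<inter> N\<close>, whose index in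
  \<open>H \<inter> M\<close> divides the prime \<open>q\<close>.\<close>

lemma prime_chain_chief_factor:
  assumes chief: "chief_factor G H K"
  shows "\<lbrakk>prime_chain G N; \<not> H \<inter> N \<subseteq> K\<rbrakk> \<Longrightarrow> \<exists>q. prime q \<and> card H = q * card K"
proof (induction rule: prime_chain.induct)
  case one
  have "subgroup K G" using chief by (simp add: chief_factor_def normal_imp_subgroup)
  then show ?case using one subgroup.one_closed by blast
next
  case (step N M q)
  show ?case
  proof (cases "H \<inter> N \<subseteq> K")
    case False then show ?thesis by (rule step.IH)
  next
    case True
    have H: "H \<lhd> G" and K: "K \<lhd> G" and KH: "K \<subset> H" using chief by (auto simp: chief_factor_def)
    have sH: "subgroup H G" and sK: "subgroup K G" using H K by (simp_all add: normal_imp_subgroup)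
    have sM: "subgroup M G" using step.hyps(2) by (rule normal_imp_subgroup)
    have sN: "subgroup N G" using prime_chain_normal[OF step.hyps(1)] by (rule normal_imp_subgroup)
    have sHM: "subgroup (H \<inter> M) G" using sH sM by (rule subgroups_Inter_pair)
    have HM: "H \<inter> M \<lhd> G" using H step.hyps(2) by (rule normal_subgroup_intersect)
    have L: "K <#> (H \<inter> M) \<lhd> G" using K HM by (rule normal_subgroup_set_mult_closed)
    interpret second_isomorphism_grp K G "H \<inter> M"
      using K sHM by (simp add: second_isomorphism_grp_def second_isomorphism_grp_axioms_def)
    have "K <#> (H \<inter> M) \<subseteq> H"
      using KH subgroup.m_closed[OF sH] by (auto simp: set_mult_def)
    moreover have "K \<subset> K <#> (H \<inter> M)"
      using H_contained_in_set_mult S_contained_in_set_mult step.prems by blast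
    ultimately have "K <#> (H \<inter> M) = H" using chief L by (auto simp: chief_factor_def)
    then have 1: "card H * card (K \<inter> (H \<inter> M)) = card K * card (H \<inter> M)"
      using card_set_mult_normal[OF K sHM] by simp
    obtain d e where de: "q = d * e" "card (H \<inter> M) = e * card (H \<inter> N)"
      using index_set_mult_Int[OF H sN sM step.hyps(3,5)] .
    have sHN: "subgroup (H \<inter> N) G" using sH sN by (rule subgroups_Inter_pair)
    have sKHM: "subgroup (K \<inter> (H \<inter> M)) G" using sK sHM by (rule subgroups_Inter_pair)
    have "H \<inter> N \<subseteq> K \<inter> (H \<inter> M)" using True step.hyps(3) by blast
    then obtain u where u: "card (K \<inter> (H \<inter> M)) = card (H \<inter> N) * u"
      using card_subgroup_dvd[OF sHN sKHM] by (auto simp: dvd_def)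
    obtain v where v: "card (H \<inter> M) = card (K \<inter> (H \<inter> M)) * v"
      using card_subgroup_dvd[OF sKHM sHM] by (auto simp: dvd_def)
    have pos: "0 < card (K \<inter> (H \<inter> M))" "0 < card (H \<inter> N)"
      using card_subgroup_pos[OF sKHM] card_subgroup_pos[OF sHN] by auto
    have "card (H \<inter> N) * (u * v) = card (H \<inter> N) * e"
      using de(2) u v by (simp add: mult_ac)
    then have "u * v = e" using pos by simp
    then have "v dvd q" using de(1) by auto
    moreover have "card H = v * card K" using 1 v pos by (simp add: mult_ac)
    moreover have "v \<noteq> 1"
      using calculation(2) KH finite_subgroup[OF sH] by (metis mult_1 psubset_card_mono less_irrefl)
    ultimately show ?thesis using step.hyps(4) prime_nat_iff by blast
  qed
qed

text \<open>A maximal member \<open>M\<close> among the normal subgroups of \<open>G\<close>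
  properly inside \<open>N\<close> gives a chief factor at the top; the induction continues with
  \<open>M\<close>.\<close>

lemma prime_chain_of_chief_factors:
  "\<lbrakk>N \<lhd> G; \<And>H K. \<lbrakk>chief_factor G H K; H \<subseteq> N\<rbrakk> \<Longrightarrow> \<exists>q. prime q \<and> card H = q * card K\<rbrakk>
    \<Longrightarrow> prime_chain G N"
proof (induction "card N" arbitrary: N rule: less_induct)
  case less
  have sN: "subgroup N G" using less.prems(1) by (rule normal_imp_subgroup)
  show ?case
  proof (cases "N = {\<one>}")
    case True then show ?thesis using prime_chain.one by simp
  next
    case False
    let ?C = "{M. M \<lhd> G \<and> M \<subset> N}"
    have "finite ?C" using finite_subgroup[OF sN] by (auto intro: rev_finite_subset[of "Pow N"])
    moreover have "{\<one>} \<in> ?C" using False subgroup.one_closed[OF sN] one_is_normal by simp blast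
    then have "?C \<noteq> {}" by (rule ex_in_conv[THEN iffD1, OF exI])
    ultimately obtain M where M: "M \<in> ?C" "\<And>L. L \<in> ?C \<Longrightarrow> M \<subseteq> L \<Longrightarrow> M = L"
      using finite_has_maximal[of ?C] by meson
    then have chief: "chief_factor G N M" using less.prems(1) by (auto simp: chief_factor_def)
    then obtain q where q: "prime q" "card N = q * card M" using less.prems(2) by blast
    have "prime_chain G M"
    proof (rule less.hyps)
      show "card M < card N" using M(1) finite_subgroup[OF sN] by (simp add: psubset_card_mono)
      show "M \<lhd> G" using M(1) by simp
      show "\<exists>q. prime q \<and> card H = q * card K" if "chief_factor G H K" "H \<subseteq> M" for H K
        using less.prems(2)[OF that(1)] that(2) M(1) by blast
    qed
    then show ?thesis using prime_chain.step[OF _ less.prems(1) _ q] M(1) by blast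
  qed
qed

section \<open>Chains, the supersolvable hypercenter and the largest normal
  \<open>p\<close>-subgroup\<close>

lemma prime_chain_iff:
  "prime_chain G N \<longleftrightarrow> N \<lhd> G \<and> (\<forall>H K. chief_factor G H K \<and> H \<subseteq> N \<longrightarrow>
     cyclic_group (G\<lparr>carrier := H\<rparr> Mod K) \<and> prime (order (G\<lparr>carrier := H\<rparr> Mod K)))"
proof safe
  assume N: "prime_chain G N"
  then show "N \<lhd> G" by (rule prime_chain_normal)
  fix H K assume HK: "chief_factor G H K" "H \<subseteq> N"
  then have "\<not> H \<inter> N \<subseteq> K" by (auto simp: chief_factor_def)
  then obtain q where q: "card H = q * card K" "prime q"
    using prime_chain_chief_factor[OF HK(1) N] by blast
  have "subgroup H G" "K \<lhd> G" "K \<subseteq> H" using HK(1) by (auto simp: chief_factor_def normal_imp_subgroup)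
  from cyclic_FactGroup_of_prime_index[OF this q]
  show "cyclic_group (G\<lparr>carrier := H\<rparr> Mod K)" "prime (order (G\<lparr>carrier := H\<rparr> Mod K))"
    using q by simp_all
next
  assume "N \<lhd> G" and *: "\<forall>H K. chief_factor G H K \<and> H \<subseteq> N \<longrightarrow>
     cyclic_group (G\<lparr>carrier := H\<rparr> Mod K) \<and> prime (order (G\<lparr>carrier := H\<rparr> Mod K))"
  show "prime_chain G N"
  proof (rule prime_chain_of_chief_factors[OF \<open>N \<lhd> G\<close>])
    show "\<exists>q. prime q \<and> card H = q * card K" if "chief_factor G H K" "H \<subseteq> N" for H K
      using that * chief_factor_order by blast
  qed
qed

text \<open>A maximal \<open>M\<close> with the property absorbs every other \<open>N\<close>,
  because \<open>M <#> N\<close> has the property too. Serves both uses of \<open>Greatest\<close>,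
  for the hypercenter and for \<open>p_core\<close>.\<close>

lemma greatest_normal_subgroup:
  assumes one: "P {\<one>}" and nor: "\<And>N. P N \<Longrightarrow> N \<lhd> G"
    and mult: "\<And>M N. \<lbrakk>P M; P N\<rbrakk> \<Longrightarrow> P (M <#> N)"
  shows "P (Greatest P)" "P N \<Longrightarrow> N \<subseteq> Greatest P"
proof -
  have sub: "N \<subseteq> carrier G" if "P N" for N
    using nor[OF that] by (simp add: normal_imp_subgroup subgroup.subset)
  have "{N. P N} \<subseteq> Pow (carrier G)" by (auto dest: sub)
  then have "finite {N. P N}" by (rule finite_subset) simp
  then obtain M where M: "P M" "\<And>L. P L \<Longrightarrow> M \<subseteq> L \<Longrightarrow> M = L"
    using finite_has_maximal[of "{N. P N}"] one by (metis (mono_tags, lifting) mem_Collect_eq empty_iff)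
  have max: "N \<subseteq> M" if N: "P N" for N
  proof -
    interpret second_isomorphism_grp M G N
      using nor M(1) N by (simp add: second_isomorphism_grp_def second_isomorphism_grp_axioms_def normal_imp_subgroup)
    have "M = M <#> N" using M mult N H_contained_in_set_mult by blast
    then show ?thesis using S_contained_in_set_mult by simp
  qed
  then have "Greatest P = M" using M(1) by (intro Greatest_equality) auto
  then show "P (Greatest P)" "P N \<Longrightarrow> N \<subseteq> Greatest P" using M(1) max by auto
qed

lemma prime_chain_supersolvable_hypercenter: "prime_chain G (supersolvable_hypercenter G)"
proof -
  \<comment> \<open>The right-hand side of \<open>prime_chain_iff\<close> is word for word the
    property in the definition of the hypercenter.\<close>
  have "supersolvable_hypercenter G = Greatest (prime_chain G)"
    unfolding supersolvable_hypercenter_def prime_chain_iff[symmetric] ..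
  then show ?thesis
    using greatest_normal_subgroup(1)[of "prime_chain G"] prime_chain.one prime_chain_normal
      prime_chain_set_mult by metis
qed

text \<open>Clear from the description by chief factors, which passes at once to smaller normal
  subgroups.\<close>

lemma prime_chain_subset:
  assumes "prime_chain G N" "M \<lhd> G" "M \<subseteq> N"
  shows "prime_chain G M"
  using assms unfolding prime_chain_iff by blast

lemma p_core_greatest:
  shows "p_core G p \<lhd> G" "\<exists>n. card (p_core G p) = p ^ n"
    "\<lbrakk>N \<lhd> G; card N = p ^ n\<rbrakk> \<Longrightarrow> N \<subseteq> p_core G p"
proof -
  let ?P = "\<lambda>N. N \<lhd> G \<and> (\<exists>n. card N = p ^ n)"
  have one: "?P {\<one>}" using one_is_normal by (auto intro: exI[of _ 0])
  have mult: "?P (M <#> N)" if MN: "?P M" "?P N" for M N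
  proof -
    have "subgroup (M <#> N) G" using MN mult_norm_subgroup normal_imp_subgroup by metis
    have "card (M <#> N) dvd card M * card N"
      using card_set_mult_normal[of M N] MN by (metis dvd_triv_left normal_imp_subgroup)
    then obtain n where "card (M <#> N) = p ^ n"
      using MN divides_primepow_nat[OF prime] by (auto simp flip: power_add)
    then show ?thesis using MN normal_subgroup_set_mult_closed by blast
  qed
  note g = greatest_normal_subgroup[of ?P, OF one _ mult]
  show "p_core G p \<lhd> G" "\<exists>n. card (p_core G p) = p ^ n" using g(1) by (auto simp: p_core_def)
  show "N \<subseteq> p_core G p" if "N \<lhd> G" "card N = p ^ n"
    unfolding p_core_def using that by (intro g(2)) auto
qed

end

section \<open>Stabilizers of chains\<close>

definition centralizer :: "('a, 'b) monoid_scheme \<Rightarrow> 'a set \<Rightarrow> 'a set" where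
  "centralizer G H = {c \<in> carrier G. \<forall>h\<in>H. c \<otimes>\<^bsub>G\<^esub> h = h \<otimes>\<^bsub>G\<^esub> c}"

context finite_group_prime
begin

section \<open>Centralizers and actions on the factors of a chain\<close>

lemma subgroup_centralizer:
  assumes "H \<subseteq> carrier G"
  shows "subgroup (centralizer G H) G"
proof (rule subgroupI)
  show "centralizer G H \<subseteq> carrier G" "centralizer G H \<noteq> {}"
    using assms by (auto simp: centralizer_def subset_iff intro!: exI[of _ \<one>])
next
  fix a assume "a \<in> centralizer G H"
  then have a: "a \<in> carrier G" "\<And>h. h \<in> H \<Longrightarrow> a \<otimes> h = h \<otimes> a" by (auto simp: centralizer_def)
  have "inv a \<otimes> h = h \<otimes> inv a" if h: "h \<in> H" for h
  proof -
    have hc: "h \<in> carrier G" using h assms by blast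
    have "inv a \<otimes> (a \<otimes> h) \<otimes> inv a = inv a \<otimes> (h \<otimes> a) \<otimes> inv a" using a(2)[OF h] by simp
    then show ?thesis using a(1) hc by (simp add: m_assoc)
  qed
  then show "inv a \<in> centralizer G H" using a(1) by (simp add: centralizer_def)
next
  fix a b assume "a \<in> centralizer G H" "b \<in> centralizer G H"
  then have *: "a \<in> carrier G" "b \<in> carrier G" "\<And>h. h \<in> H \<Longrightarrow> a \<otimes> h = h \<otimes> a" "\<And>h. h \<in> H \<Longrightarrow> b \<otimes> h = h \<otimes> b"
    by (auto simp: centralizer_def)
  have "a \<otimes> b \<otimes> h = h \<otimes> (a \<otimes> b)" if h: "h \<in> H" for h
  proof -
    have hc: "h \<in> carrier G" using h assms by blast
    have "a \<otimes> b \<otimes> h = a \<otimes> (h \<otimes> b)" using * hc h by (simp add: m_assoc)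
    also have "\<dots> = h \<otimes> a \<otimes> b" using * hc h by (simp flip: m_assoc)
    finally show ?thesis using * hc by (simp add: m_assoc)
  qed
  then show "a \<otimes> b \<in> centralizer G H" using * by (simp add: centralizer_def)
qed

lemma normal_centralizer:
  assumes N: "N \<lhd> G"
  shows "centralizer G N \<lhd> G"
proof -
  have Nc: "\<And>n. n \<in> N \<Longrightarrow> n \<in> carrier G" using subgroup.mem_carrier[OF normal_imp_subgroup[OF N]] .
  have "x \<otimes> c \<otimes> inv x \<in> centralizer G N" if x: "x \<in> carrier G" and "c \<in> centralizer G N" for x c
  proof -
    have c: "c \<in> carrier G" "\<And>n. n \<in> N \<Longrightarrow> c \<otimes> n = n \<otimes> c"
      using that(2) by (auto simp: centralizer_def)
    have "x \<otimes> c \<otimes> inv x \<otimes> n = n \<otimes> (x \<otimes> c \<otimes> inv x)" if n: "n \<in> N" for n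
    proof -
      have "x \<otimes> (c \<otimes> (inv x \<otimes> n \<otimes> x)) \<otimes> inv x = x \<otimes> (inv x \<otimes> n \<otimes> x \<otimes> c) \<otimes> inv x"
        using c(2)[OF normal.inv_op_closed1[OF N x n]] by simp
      then show ?thesis using x c(1) Nc[OF n] by (simp add: m_assoc)
    qed
    then show ?thesis using x c(1) by (simp add: centralizer_def)
  qed
  then show ?thesis
    using subgroup_centralizer[of N] Nc by (auto simp: normal_inv_iff)
qed

lemma subgroup_pow_card:
  assumes "subgroup H G" "x \<in> H"
  shows "x [^] card H = \<one>"
  using group.pow_order_eq_1[OF subgroup_imp_group[OF assms(1)], of x] assms(2)
  by (simp add: order_def flip: nat_pow_consistent)

lemma rcoset_conj:
  assumes N: "N \<lhd> G" and x: "x \<in> carrier G" and m: "m \<in> carrier G"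
  shows "(\<lambda>c. x \<otimes> c \<otimes> inv x) ` (N #> m) = N #> (x \<otimes> m \<otimes> inv x)"
proof -
  have Nc: "\<And>n. n \<in> N \<Longrightarrow> n \<in> carrier G" using subgroup.mem_carrier[OF normal_imp_subgroup[OF N]] .
  show ?thesis
  proof (intro equalityI subsetI)
    fix y assume "y \<in> (\<lambda>c. x \<otimes> c \<otimes> inv x) ` (N #> m)"
    then obtain n where n: "n \<in> N" "y = x \<otimes> (n \<otimes> m) \<otimes> inv x" by (auto simp: r_coset_def)
    then have "y = (x \<otimes> n \<otimes> inv x) \<otimes> (x \<otimes> m \<otimes> inv x)" using x m Nc[OF n(1)] by (simp add: m_assoc)
    then show "y \<in> N #> (x \<otimes> m \<otimes> inv x)"
      using normal.inv_op_closed2[OF N x n(1)] by (auto simp: r_coset_def)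
  next
    fix y assume "y \<in> N #> (x \<otimes> m \<otimes> inv x)"
    then obtain n where n: "n \<in> N" "y = n \<otimes> (x \<otimes> m \<otimes> inv x)" by (auto simp: r_coset_def)
    then have "y = x \<otimes> ((inv x \<otimes> n \<otimes> x) \<otimes> m) \<otimes> inv x" using x m Nc[OF n(1)] by (simp add: m_assoc)
    then show "y \<in> (\<lambda>c. x \<otimes> c \<otimes> inv x) ` (N #> m)"
      using normal.inv_op_closed1[OF N x n(1)] by (auto simp: r_coset_def)
  qed
qed

text \<open>The group acts by conjugation on the \<open>p\<close> cosets of \<open>N\<close> in \<open>M\<close> and fixes the trivial one,
  so the number of fixed cosets is a positive multiple of \<open>p\<close>.\<close>

lemma p_subgroup_acts_trivially:
  assumes T: "subgroup T G" "card T = p ^ k"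
    and N: "N \<lhd> G" and M: "M \<lhd> G" "N \<subseteq> M" "card M = p * card N"
    and x: "x \<in> T" and m: "m \<in> M"
  shows "x \<otimes> m \<otimes> inv x \<otimes> inv m \<in> N"
proof -
  interpret T: group "G\<lparr>carrier := T\<rparr>" using T(1) by (rule subgroup_imp_group)
  have sN: "subgroup N G" and sM: "subgroup M G" using N M by (simp_all add: normal_imp_subgroup)
  have Tc: "\<And>t. t \<in> T \<Longrightarrow> t \<in> carrier G" using subgroup.mem_carrier[OF T(1)] .
  have Mc: "\<And>t. t \<in> M \<Longrightarrow> t \<in> carrier G" using subgroup.mem_carrier[OF sM] .
  have Nc: "\<And>t. t \<in> N \<Longrightarrow> t \<in> carrier G" using subgroup.mem_carrier[OF sN] .
  define E where "E = (\<lambda>m. N #> m) ` M"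
  define a where "a x C = (\<lambda>c. x \<otimes> c \<otimes> inv x) ` C" for x C
  have a: "a t (N #> m) = N #> (t \<otimes> m \<otimes> inv t)" if "t \<in> T" "m \<in> M" for t m
    using rcoset_conj[OF N Tc[OF that(1)] Mc[OF that(2)]] by (simp add: a_def)
  have conj: "t \<otimes> m \<otimes> inv t \<in> M" if "t \<in> T" "m \<in> M" for t m
    using normal.inv_op_closed2[OF M(1) Tc[OF that(1)] that(2)] .
  have "rcosets\<^bsub>G\<lparr>carrier := M\<rparr>\<^esub> N = E" by (auto simp: RCOSETS_def E_def)
  then have "card E * card N = card M"
    using group.lagrange[OF subgroup_imp_group[OF sM] subgroup_incl[OF sN sM M(2)]]
    by (simp add: order_def)
  then have cE: "card E = p" using M(3) card_subgroup_pos[OF sN] by simp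
  have fE: "finite E" using finite_subgroup[OF sM] by (simp add: E_def)
  let ?F = "{C \<in> E. \<forall>t\<in>carrier (G\<lparr>carrier := T\<rparr>). a t C = C}"
  have "p dvd card ?F"
  proof (rule T.p_group_dvd_fixed[OF prime _ fE])
    show "order (G\<lparr>carrier := T\<rparr>) = p ^ k" using T by (simp add: order_def)
    show "a t C \<in> E" if "t \<in> carrier (G\<lparr>carrier := T\<rparr>)" "C \<in> E" for t C
      using that conj a by (auto simp: E_def)
    show "a \<one>\<^bsub>G\<lparr>carrier := T\<rparr>\<^esub> C = C" if "C \<in> E" for C
      using that a[OF subgroup.one_closed[OF T(1)]] Mc by (auto simp: E_def)
    show "a (t \<otimes>\<^bsub>G\<lparr>carrier := T\<rparr>\<^esub> u) C = a t (a u C)"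
      if tu: "t \<in> carrier (G\<lparr>carrier := T\<rparr>)" "u \<in> carrier (G\<lparr>carrier := T\<rparr>)" and C: "C \<in> E" for t u C
    proof -
      obtain n where n: "n \<in> M" "C = N #> n" using C by (auto simp: E_def)
      have "t \<otimes> u \<in> T" using tu subgroup.m_closed[OF T(1)] by simp
      then show ?thesis
        using tu n a conj Tc Mc by (simp add: inv_mult_group m_assoc)
    qed
    show "p dvd card E" using cE by simp
  qed
  moreover have "N #> \<one> \<in> ?F"
    using a[OF _ subgroup.one_closed[OF sM]] Tc subgroup.one_closed[OF sM] by (auto simp: E_def)
  then have "card ?F \<noteq> 0" using fE by (auto simp: card_eq_0_iff)
  moreover have "card ?F \<le> p" using cE fE by (metis (no_types, lifting) card_mono mem_Collect_eq subsetI)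
  ultimately have "card ?F = card E" using cE by (auto dest: dvd_imp_le)
  then have F: "?F = E" using fE by (intro card_subset_eq) auto
  have "N #> m \<in> E" using m by (simp add: E_def)
  with F have "N #> m \<in> ?F" by simp
  then have "a x (N #> m) = N #> m" using x by simp
  then have "N #> (x \<otimes> m \<otimes> inv x) = N #> m" using a x m by simp
  then have "x \<otimes> m \<otimes> inv x \<in> N #> m"
    using rcos_self[OF _ sN] x m Tc Mc by (metis inv_closed m_closed)
  then obtain n where n: "n \<in> N" "x \<otimes> m \<otimes> inv x = n \<otimes> m" by (auto simp: r_coset_def)
  then show ?thesis using Mc[OF m] Nc[OF n(1)] by (simp add: m_assoc)
qed

text \<open>Here \<open>n\<close> is the commutator of \<open>y\<close> and \<open>m\<close>. As it
  commutes with \<open>y\<close>, the commutator of \<open>y [^] i\<close> and \<open>m\<close> is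
  \<open>n [^] i\<close>.\<close>

lemma commute_pow:
  assumes y: "y \<in> carrier G" and m: "m \<in> carrier G" and n: "n \<in> carrier G"
    and yn: "y \<otimes> n = n \<otimes> y" and ym: "y \<otimes> m = n \<otimes> m \<otimes> y"
  shows "y [^] (i::nat) \<otimes> m = n [^] i \<otimes> m \<otimes> y [^] i"
proof (induction i)
  case (Suc i)
  have yni: "y [^] i \<otimes> n = n \<otimes> y [^] i"
    using group_commutes_pow[OF yn y n] .
  have "y [^] Suc i \<otimes> m = y [^] i \<otimes> (n \<otimes> m \<otimes> y)" using y m n ym by (simp add: m_assoc)
  also have "\<dots> = n \<otimes> (y [^] i \<otimes> m) \<otimes> y" using y m n yni by (simp flip: m_assoc)
  also have "\<dots> = n \<otimes> n [^] i \<otimes> m \<otimes> (y [^] i \<otimes> y)" using y m n Suc by (simp add: m_assoc)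
  finally show ?case using n by (metis nat_pow_Suc nat_pow_Suc2)
qed (use y m n in simp)

text \<open>\<open>A\<close> is the subgroup acting trivially on every factor of the chain.\<close>

lemma prime_chain_stabilizer:
  "\<lbrakk>prime_chain G N; card N = p ^ k\<rbrakk> \<Longrightarrow> \<exists>A. A \<lhd> G \<and> centralizer G N \<subseteq> A \<and>
     (\<forall>x\<in>A. \<exists>j. x [^] (p ^ j) \<in> centralizer G N) \<and>
     (\<forall>T. subgroup T G \<and> (\<exists>i. card T = p ^ i) \<longrightarrow> T \<subseteq> A)"
proof (induction arbitrary: k rule: prime_chain.induct)
  case one
  \<comment> \<open>For the trivial chain the whole group serves as stabilizer.\<close>
  have "x \<in> centralizer G {\<one>}" if "x \<in> carrier G" for x
    using that by (simp add: centralizer_def)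
  then show ?case using normal_self
    by (intro exI[of _ "carrier G"]) (auto simp: centralizer_def dest: subgroup.subset)
next
  case (step N M q)
  have N: "N \<lhd> G" and M: "M \<lhd> G" using step.hyps prime_chain_normal by auto
  have sN: "subgroup N G" and sM: "subgroup M G" using N M by (simp_all add: normal_imp_subgroup)
  have Nc: "\<And>n. n \<in> N \<Longrightarrow> n \<in> carrier G" using subgroup.mem_carrier[OF sN] .
  have Mc: "\<And>n. n \<in> M \<Longrightarrow> n \<in> carrier G" using subgroup.mem_carrier[OF sM] .
  obtain l where l: "card N = p ^ l" using p_group_subgroup_card[OF sN sM step.hyps(3) step.prems] .
  have "q dvd p ^ k" using step.hyps(5) step.prems by (metis dvd_triv_left)
  then have "q = p" using step.hyps(4) prime by (metis prime_dvd_power primes_dvd_imp_eq)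
  then have cM: "card M = p * card N" using step.hyps(5) by simp
  obtain A where A: "A \<lhd> G" "centralizer G N \<subseteq> A"
    "\<And>x. x \<in> A \<Longrightarrow> \<exists>j. x [^] (p ^ j) \<in> centralizer G N"
    "\<And>T i. subgroup T G \<Longrightarrow> card T = p ^ i \<Longrightarrow> T \<subseteq> A"
    using step.IH[OF l] by blast
  have sA: "subgroup A G" using A(1) by (rule normal_imp_subgroup)
  have Ac: "\<And>n. n \<in> A \<Longrightarrow> n \<in> carrier G" using subgroup.mem_carrier[OF sA] .
  \<comment> \<open>The elements of \<open>A\<close> that act trivially on the new top factor
    \<open>M / N\<close> as well, expressed by commutators.\<close>
  define B where "B = {x \<in> A. \<forall>m\<in>M. x \<otimes> m \<otimes> inv x \<otimes> inv m \<in> N}"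
  have sB: "subgroup B G"
  proof (rule subgroupI)
    show "B \<subseteq> carrier G" using Ac by (auto simp: B_def)
    have "\<one> \<in> B" using subgroup.one_closed[OF sA] subgroup.one_closed[OF sN] Mc by (simp add: B_def)
    then show "B \<noteq> {}" by blast
  next
    fix x assume "x \<in> B"
    then have x: "x \<in> A" "\<And>m. m \<in> M \<Longrightarrow> x \<otimes> m \<otimes> inv x \<otimes> inv m \<in> N" by (auto simp: B_def)
    have "inv x \<otimes> m \<otimes> inv (inv x) \<otimes> inv m \<in> N" if m: "m \<in> M" for m
    proof -
      \<comment> \<open>With \<open>[x,m]\<close> for the commutator in \<open>B\<close>, this is
        the identity \<open>[x^-1,m] = x^-1 [x,m]^-1 x\<close>.\<close>
      have "inv x \<otimes> inv (x \<otimes> m \<otimes> inv x \<otimes> inv m) \<otimes> x \<in> N"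
        using normal.inv_op_closed1[OF N Ac[OF x(1)] subgroup.m_inv_closed[OF sN x(2)[OF m]]] .
      then show ?thesis using Ac[OF x(1)] Mc[OF m] by (simp add: inv_mult_group m_assoc)
    qed
    then show "inv x \<in> B" using subgroup.m_inv_closed[OF sA x(1)] by (simp add: B_def)
  next
    fix x y assume "x \<in> B" "y \<in> B"
    then have x: "x \<in> A" "\<And>m. m \<in> M \<Longrightarrow> x \<otimes> m \<otimes> inv x \<otimes> inv m \<in> N"
      and y: "y \<in> A" "\<And>m. m \<in> M \<Longrightarrow> y \<otimes> m \<otimes> inv y \<otimes> inv m \<in> N" by (auto simp: B_def)
    have "x \<otimes> y \<otimes> m \<otimes> inv (x \<otimes> y) \<otimes> inv m \<in> N" if m: "m \<in> M" for m
    proof -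
      \<comment> \<open>The identity \<open>[xy,m] = (x [y,m] x^-1) [x,m]\<close>.\<close>
      have "(x \<otimes> (y \<otimes> m \<otimes> inv y \<otimes> inv m) \<otimes> inv x) \<otimes> (x \<otimes> m \<otimes> inv x \<otimes> inv m) \<in> N"
        using subgroup.m_closed[OF sN normal.inv_op_closed2[OF N Ac[OF x(1)] y(2)[OF m]] x(2)[OF m]] .
      then show ?thesis using Ac[OF x(1)] Ac[OF y(1)] Mc[OF m] by (simp add: inv_mult_group m_assoc)
    qed
    then show "x \<otimes> y \<in> B" using subgroup.m_closed[OF sA x(1) y(1)] by (simp add: B_def)
  qed
  have nB: "B \<lhd> G"
  proof -
    have "g \<otimes> x \<otimes> inv g \<in> B" if g: "g \<in> carrier G" and "x \<in> B" for g x
    proof -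
      have x: "x \<in> A" "\<And>m. m \<in> M \<Longrightarrow> x \<otimes> m \<otimes> inv x \<otimes> inv m \<in> N" using that by (auto simp: B_def)
      have "(g \<otimes> x \<otimes> inv g) \<otimes> m \<otimes> inv (g \<otimes> x \<otimes> inv g) \<otimes> inv m \<in> N" if m: "m \<in> M" for m
      proof -
        have "g \<otimes> (x \<otimes> (inv g \<otimes> m \<otimes> g) \<otimes> inv x \<otimes> inv (inv g \<otimes> m \<otimes> g)) \<otimes> inv g \<in> N"
          using normal.inv_op_closed2[OF N g x(2)[OF normal.inv_op_closed1[OF M g m]]] .
        then show ?thesis using g Ac[OF x(1)] Mc[OF m] by (simp add: inv_mult_group m_assoc)
      qed
      then show ?thesis using normal.inv_op_closed2[OF A(1) g x(1)] by (simp add: B_def)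
    qed
    then show ?thesis using sB by (simp add: normal_inv_iff)
  qed
  moreover have "centralizer G M \<subseteq> B"
  proof
    fix c assume "c \<in> centralizer G M"
    then have c: "c \<in> carrier G" "\<And>m. m \<in> M \<Longrightarrow> c \<otimes> m = m \<otimes> c" by (auto simp: centralizer_def)
    have "c \<in> centralizer G N" using c step.hyps(3) by (auto simp: centralizer_def)
    moreover have "c \<otimes> m \<otimes> inv c \<otimes> inv m \<in> N" if m: "m \<in> M" for m
      using c Mc[OF m] m subgroup.one_closed[OF sN] by (simp add: m_assoc)
    ultimately show "c \<in> B" using A(2) by (auto simp: B_def)
  qed
  moreover have "\<exists>j. x [^] (p ^ j) \<in> centralizer G M" if xB: "x \<in> B" for x
  proof -
    have xA: "x \<in> A" using xB by (simp add: B_def)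
    obtain j where j: "x [^] (p ^ j) \<in> centralizer G N" using A(3)[OF xA] by blast
    \<comment> \<open>This power centralizes \<open>N\<close> and remains in \<open>B\<close>, so
      its commutators with elements of \<open>M\<close> lie in \<open>N\<close> and commute with it.
      By \<open>commute_pow\<close> a further power with exponent \<open>p ^ l = card N\<close>
      kills these commutators and hence centralizes \<open>M\<close>.\<close>
    define y where "y = x [^] (p ^ j)"
    have xc: "x \<in> carrier G" using Ac[OF xA] .
    have yc: "y \<in> carrier G" using xc by (simp add: y_def)
    have "y \<in> B" unfolding y_def
      using xB monoid.nat_pow_closed[OF group.is_monoid[OF subgroup_imp_group[OF sB]], of x "p ^ j"]
      by (simp flip: nat_pow_consistent)
    then have yB: "y \<otimes> m \<otimes> inv y \<otimes> inv m \<in> N" if "m \<in> M" for m using that by (simp add: B_def)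
    have "y [^] (p ^ l) \<otimes> m = m \<otimes> y [^] (p ^ l)" if m: "m \<in> M" for m
    proof -
      let ?n = "y \<otimes> m \<otimes> inv y \<otimes> inv m"
      have nN: "?n \<in> N" using yB[OF m] .
      have "y \<otimes> ?n = ?n \<otimes> y" using j nN by (simp add: y_def centralizer_def)
      moreover have "y \<otimes> m = ?n \<otimes> m \<otimes> y" using yc Mc[OF m] by (simp add: m_assoc)
      ultimately have "y [^] (p ^ l) \<otimes> m = ?n [^] (p ^ l) \<otimes> m \<otimes> y [^] (p ^ l)"
        using commute_pow[OF yc Mc[OF m] Nc[OF nN]] by blast
      moreover have "?n [^] (p ^ l) = \<one>" using subgroup_pow_card[OF sN nN] l by simp
      ultimately show ?thesis using yc Mc[OF m] by simp
    qed
    then have "y [^] (p ^ l) \<in> centralizer G M" using yc by (simp add: centralizer_def)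
    then show ?thesis using xc by (auto simp: y_def nat_pow_pow simp flip: power_add)
  qed
  moreover have "T \<subseteq> B" if T: "subgroup T G" "card T = p ^ i" for T i
    using A(4)[OF T] p_subgroup_acts_trivially[OF T N M step.hyps(3) cM] by (auto simp: B_def)
  ultimately show ?case by (intro exI[of _ B]) blast
qed

text \<open>For a prime \<open>q\<close> dividing the order of the quotient, Sylow's theorem with
  exponent 1 gives a subgroup of order \<open>q\<close>, hence an element of order \<open>q\<close>.
  Elements of the quotient have \<open>p\<close>-power order, so \<open>q = p\<close>.\<close>

lemma index_p_power:
  assumes C: "C \<lhd> G" and pow: "\<And>x. x \<in> carrier G \<Longrightarrow> \<exists>j. x [^] (p ^ j) \<in> C"
  shows "\<exists>i. order G = p ^ i * card C"
proof -
  interpret C: normal C G by (rule C)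
  interpret Q: group "G Mod C" by (rule C.factorgroup_is_group)
  let ?r = "order (G Mod C)"
  have fin: "finite (carrier (G Mod C))" by (simp add: FactGroup_def finite_rcosets)
  have L: "?r * card C = order G"
    using lagrange[OF C.subgroup_axioms] by (simp add: order_def FactGroup_def)
  have r0: "?r \<noteq> 0" using fin Q.order_gt_0_iff_finite by simp
  have eq: "q = p" if q: "prime q" "q dvd ?r" for q
  proof -
    obtain m where "?r = q ^ 1 * m" using q(2) by (auto simp: dvd_def)
    then obtain A where A: "subgroup A (G Mod C)" "card A = q"
      using sylow_thm[OF q(1) C.factorgroup_is_group _ fin, of 1] by auto
    have "A \<noteq> {\<one>\<^bsub>G Mod C\<^esub>}" using A(2) q(1) by auto
    then obtain X where X: "X \<in> A" "X \<noteq> \<one>\<^bsub>G Mod C\<^esub>" using subgroup.one_closed[OF A(1)] by blast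
    have Xc: "X \<in> carrier (G Mod C)" using subgroup.mem_carrier[OF A(1) X(1)] .
    then obtain x where x: "x \<in> carrier G" "X = C #> x" by (auto simp: carrier_FactGroup)
    obtain j where "x [^] (p ^ j) \<in> C" using pow[OF x(1)] by blast
    then have "X [^]\<^bsub>G Mod C\<^esub> (p ^ j) = \<one>\<^bsub>G Mod C\<^esub>"
      using C.FactGroup_pow[OF x(1)] x by (simp add: coset_join2 C.subgroup_axioms)
    then have 1: "Q.ord X dvd p ^ j" using Q.pow_eq_id[OF Xc] by simp
    have "X [^]\<^bsub>G Mod C\<^esub> q = \<one>\<^bsub>G Mod C\<^esub>"
      using group.pow_order_eq_1[OF Q.subgroup_imp_group[OF A(1)], of X] X A(2)
      by (simp add: order_def flip: Q.nat_pow_consistent)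
    then have "Q.ord X dvd q" using Q.pow_eq_id[OF Xc] by simp
    moreover have "Q.ord X \<noteq> 1" using Q.ord_eq_1[OF Xc] X(2) by simp
    ultimately have "Q.ord X = q" using q(1) by (auto simp: prime_nat_iff)
    then show ?thesis using 1 q(1) prime by (metis prime_dvd_power primes_dvd_imp_eq)
  qed
  obtain m where m: "?r = p ^ multiplicity p ?r * m" "\<not> p dvd m"
    using multiplicity_decompose'[OF r0, of p] prime by (metis not_prime_unit)
  have "m = 1"
  proof (rule ccontr)
    assume "m \<noteq> 1"
    then obtain q where "prime q" "q dvd m" using prime_factor_nat by blast
    then show False using eq[of q] m by (metis dvd_mult)
  qed
  then show ?thesis using L m(1) by (metis mult.right_neutral)
qed

text \<open>The stabilizer \<open>A\<close> contains \<open>T\<close>, and the centralizer of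
  \<open>U\<close> has \<open>p\<close>-power index in it. The index \<open>e\<close> of
  \<open>centralizer G U <#> T\<close> in \<open>A\<close> is thus a power of \<open>p\<close>; it
  is also prime to \<open>p\<close>, because \<open>T\<close> is Sylow in \<open>A\<close>. Hence
  this product is all of \<open>A\<close>, and Frattini for \<open>A\<close> writes \<open>x\<close>
  as \<open>c \<otimes> t \<otimes> n\<close>, where \<open>t\<close> in \<open>T\<close> is
  absorbed by the normalizer of \<open>T\<close>.\<close>

lemma prime_chain_factorization:
  assumes U: "prime_chain G U" "card U = p ^ k" and T: "sylow_subgroup G p T" and x: "x \<in> carrier G"
  obtains c n where "c \<in> centralizer G U" "n \<in> normalizer G T" "x = c \<otimes> n"
proof -
  obtain A where A: "A \<lhd> G" "centralizer G U \<subseteq> A"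
    "\<And>x. x \<in> A \<Longrightarrow> \<exists>j. x [^] (p ^ j) \<in> centralizer G U"
    "\<And>T i. subgroup T G \<Longrightarrow> card T = p ^ i \<Longrightarrow> T \<subseteq> A"
    using prime_chain_stabilizer[OF U] by blast
  let ?C = "centralizer G U"
  have C: "?C \<lhd> G" using prime_chain_normal[OF U(1)] by (rule normal_centralizer)
  have sA: "subgroup A G" and sC: "subgroup ?C G" using A(1) C by (simp_all add: normal_imp_subgroup)
  have sT: "subgroup T G" using T by (simp add: sylow_subgroup_def)
  have TA: "T \<subseteq> A" using T by (intro A(4)) (auto simp: sylow_subgroup_def)
  interpret A: finite_group_prime "G\<lparr>carrier := A\<rparr>" p using sA by (rule subgroup_finite_group_prime)
  have TS: "sylow_subgroup (G\<lparr>carrier := A\<rparr>) p T"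
    using sylow_Int_normal[OF T A(1)] TA by (simp add: Int_absorb1)
  then obtain n m where m: "card T = p ^ n" "card A = p ^ n * m" "\<not> p dvd m"
    unfolding A.sylow_subgroup_iff by (auto simp: order_def)
  have "\<exists>i. order (G\<lparr>carrier := A\<rparr>) = p ^ i * card ?C"
  proof (rule A.index_p_power)
    show "?C \<lhd> G\<lparr>carrier := A\<rparr>" using sA C A(2) by (rule normal_restrict_supergroup)
    show "\<exists>j. x [^]\<^bsub>G\<lparr>carrier := A\<rparr>\<^esub> (p ^ j) \<in> ?C" if "x \<in> carrier (G\<lparr>carrier := A\<rparr>)" for x
      using A(3) that by (simp flip: nat_pow_consistent)
  qed
  then obtain i where i: "card A = p ^ i * card ?C" by (auto simp: order_def)
  interpret second_isomorphism_grp ?C G T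
    using C sT by (simp add: second_isomorphism_grp_def second_isomorphism_grp_axioms_def)
  have sCT: "subgroup (?C <#> T) G" by (rule normal_set_mult_subgroup)
  have CTA: "?C <#> T \<subseteq> A"
    using A(2) TA subgroup.m_closed[OF sA] by (auto simp: set_mult_def)
  obtain e where e: "card A = card (?C <#> T) * e"
    using card_subgroup_dvd[OF sCT sA CTA] by (auto simp: dvd_def)
  obtain f where f: "card (?C <#> T) = card T * f"
    using card_subgroup_dvd[OF sT sCT S_contained_in_set_mult] by (auto simp: dvd_def)
  obtain g where g: "card (?C <#> T) = card ?C * g"
    using card_subgroup_dvd[OF sC sCT H_contained_in_set_mult] by (auto simp: dvd_def)
  have "m = f * e" using m e f prime_gt_0_nat[OF prime] by simp
  then have "\<not> p dvd e" using m(3) dvd_mult by blast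
  moreover have "p ^ i = g * e" using i e g card_subgroup_pos[OF sC] by simp
  then have "e dvd p ^ i" by simp
  then obtain l where "e = p ^ l" using divides_primepow_nat[OF prime] by blast
  ultimately have "e = 1" by (cases l) auto
  then have CT: "?C <#> T = A" using CTA e finite_subgroup[OF sA] by (intro card_subset_eq) auto
  obtain a n where an: "a \<in> A" "n \<in> normalizer G T" "x = a \<otimes> n" using frattini[OF A(1) TS x] .
  obtain c t where ct: "c \<in> ?C" "t \<in> T" "a = c \<otimes> t" using an(1) CT by (auto simp: set_mult_def)
  have sN: "subgroup (normalizer G T) G" using sT by (rule subgroup_normalizer)
  have "t \<in> normalizer G T" using subgroup_subset_normalizer[OF sT] ct(2) by blast
  then have "t \<otimes> n \<in> normalizer G T" using an(2) by (rule subgroup.m_closed[OF sN])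
  moreover have "x = c \<otimes> (t \<otimes> n)"
    using an ct subgroup.mem_carrier[OF sC ct(1)] subgroup.mem_carrier[OF sT ct(2)] subgroup.mem_carrier[OF sN an(2)]
    by (simp add: m_assoc)
  ultimately show ?thesis using that ct(1) by blast
qed

end

section \<open>Control of fusion\<close>

context finite_group_prime
begin

text \<open>The exponent notation \<open>x^g\<close>, with the side convention of
  \<open>group_fusion\<close>. This is a right action, so in a product the left factor acts
  first.\<close>

definition conj_by :: "'a \<Rightarrow> 'a \<Rightarrow> 'a" where "conj_by g x = inv g \<otimes> x \<otimes> g"

section \<open>Conjugation maps and normalizers\<close>

lemma conj_by_closed [simp]: "\<lbrakk>g \<in> carrier G; x \<in> carrier G\<rbrakk> \<Longrightarrow> conj_by g x \<in> carrier G"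
  by (simp add: conj_by_def)

lemma conj_by_mult:
  "\<lbrakk>g \<in> carrier G; h \<in> carrier G; x \<in> carrier G\<rbrakk> \<Longrightarrow> conj_by (g \<otimes> h) x = conj_by h (conj_by g x)"
  by (simp add: conj_by_def inv_mult_group m_assoc)

lemma conj_by_inv [simp]:
  "\<lbrakk>g \<in> carrier G; x \<in> carrier G\<rbrakk> \<Longrightarrow> conj_by (inv g) (conj_by g x) = x"
  "\<lbrakk>g \<in> carrier G; x \<in> carrier G\<rbrakk> \<Longrightarrow> conj_by g (conj_by (inv g) x) = x"
  by (simp_all add: conj_by_def m_assoc)

lemma conj_by_commute:
  assumes "c \<in> carrier G" "x \<in> carrier G" "c \<otimes> x = x \<otimes> c"
  shows "conj_by c x = x"
  using assms by (metis conj_by_def inv_solve_left m_assoc inv_closed m_closed)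

lemma inj_on_conj_by: "\<lbrakk>g \<in> carrier G; H \<subseteq> carrier G\<rbrakk> \<Longrightarrow> inj_on (conj_by g) H"
  by (auto simp: inj_on_def conj_by_def subset_iff)

lemma card_conj_by: "\<lbrakk>g \<in> carrier G; H \<subseteq> carrier G\<rbrakk> \<Longrightarrow> card (conj_by g ` H) = card H"
  by (simp add: card_image inj_on_conj_by)

lemma conj_by_image_inv: "\<lbrakk>g \<in> carrier G; H \<subseteq> carrier G\<rbrakk> \<Longrightarrow> conj_by (inv g) ` conj_by g ` H = H"
  by (force simp: image_image subset_iff)

lemma subgroup_conj_by:
  assumes "subgroup H G" "g \<in> carrier G"
  shows "subgroup (conj_by g ` H) G"
proof -
  have "inv g <# H #> inv (inv g) = conj_by g ` H"
    using assms by (auto simp: l_coset_def r_coset_def conj_by_def)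
  then show ?thesis using subgroup_conjugation_is_surj2[of "inv g" H] assms by simp
qed

lemma mem_normalizer:
  assumes "subgroup H G"
  shows "g \<in> normalizer G H \<longleftrightarrow> g \<in> carrier G \<and> conj_by g ` H \<subseteq> H"
  using mem_normalizer_iff[of H g] assms by (auto simp: conj_by_def finite_subgroup subgroup.subset)

lemma conj_by_normalizer_subset:
  assumes H: "subgroup H G" and g: "g \<in> carrier G"
  shows "conj_by g ` normalizer G H \<subseteq> normalizer G (conj_by g ` H)"
proof
  fix y assume "y \<in> conj_by g ` normalizer G H"
  then obtain x where x: "x \<in> carrier G" "conj_by x ` H \<subseteq> H" "y = conj_by g x"
    using H by (auto simp: mem_normalizer)
  have "conj_by y (conj_by g h) \<in> conj_by g ` H" if h: "h \<in> H" for h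
  proof -
    have "conj_by y (conj_by g h) = conj_by g (conj_by x h)"
      using x g subgroup.mem_carrier[OF H h] by (simp add: conj_by_def inv_mult_group m_assoc)
    then show ?thesis using x(2) h by auto
  qed
  then show "y \<in> normalizer G (conj_by g ` H)"
    using x g by (auto simp: mem_normalizer[OF subgroup_conj_by[OF H g]])
qed

lemma card_normalizer_conj_by:
  assumes H: "subgroup H G" and g: "g \<in> carrier G"
  shows "card (normalizer G (conj_by g ` H)) = card (normalizer G H)"
proof (rule antisym)
  have c: "subgroup (conj_by g ` H) G" using H g by (rule subgroup_conj_by)
  have n: "subgroup (normalizer G H) G" "subgroup (normalizer G (conj_by g ` H)) G"
    using subgroup_normalizer[OF H] subgroup_normalizer[OF c] .
  show "card (normalizer G H) \<le> card (normalizer G (conj_by g ` H))"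
    using card_mono[OF finite_subgroup[OF n(2)] conj_by_normalizer_subset[OF H g]]
    by (simp add: card_conj_by[OF g subgroup.subset[OF n(1)]])
  have "conj_by (inv g) ` normalizer G (conj_by g ` H) \<subseteq> normalizer G H"
    using conj_by_normalizer_subset[OF c, of "inv g"] g
    by (simp add: conj_by_image_inv subgroup.subset[OF H])
  from card_mono[OF finite_subgroup[OF n(1)] this]
  show "card (normalizer G (conj_by g ` H)) \<le> card (normalizer G H)"
    using g by (simp add: card_conj_by[OF _ subgroup.subset[OF n(2)]])
qed

text \<open>Some conjugate of \<open>N\<close> lies in \<open>T\<close>, and \<open>N\<close> equals
  all its conjugates.\<close>

lemma normal_p_subgroup_subset_sylow:
  assumes T: "sylow_subgroup G p T" and N: "N \<lhd> G" "card N = p ^ k"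
  shows "N \<subseteq> T"
proof
  fix x assume x: "x \<in> N"
  obtain g where g: "g \<in> carrier G" "\<And>x. x \<in> N \<Longrightarrow> inv g \<otimes> x \<otimes> g \<in> T"
    using sylow_contains_conjugate[OF T normal_imp_subgroup[OF N(1)] N(2)] by blast
  have xc: "x \<in> carrier G" using subgroup.mem_carrier[OF normal_imp_subgroup[OF N(1)] x] .
  have "inv g \<otimes> (g \<otimes> x \<otimes> inv g) \<otimes> g \<in> T" using g(2)[OF normal.inv_op_closed2[OF N(1) g(1) x]] .
  then show "x \<in> T" using g(1) xc by (simp add: m_assoc)
qed

text \<open>Carries facts proved in the interpretation for \<open>K\<close> over to conjugation in
  \<open>G\<close>; inverses of elements of \<open>K\<close> agree in both groups.\<close>

lemma conj_by_subgroup: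
  assumes "subgroup K G" "k \<in> K"
  shows "finite_group_prime.conj_by (G\<lparr>carrier := K\<rparr>) k = conj_by k"
  using assms by (simp add: fun_eq_iff conj_by_def m_inv_consistent
      finite_group_prime.conj_by_def[OF subgroup_finite_group_prime])

lemma normalizer_in_subgroup:
  assumes K: "subgroup K G" and H: "subgroup H G" "H \<subseteq> K"
    and k: "k \<in> normalizer (G\<lparr>carrier := K\<rparr>) H"
  shows "k \<in> K" "conj_by k ` H \<subseteq> H"
proof -
  interpret K: finite_group_prime "G\<lparr>carrier := K\<rparr>" p using K by (rule subgroup_finite_group_prime)
  have *: "k \<in> K" "K.conj_by k ` H \<subseteq> H"
    using K.mem_normalizer[OF subgroup_incl[OF H(1) K H(2)], of k] k by simp_all
  then show "k \<in> K" "conj_by k ` H \<subseteq> H" using conj_by_subgroup[OF K] by simp_all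
qed

text \<open>The 6-eternal relation enters through \<open>chain\<close>: the two conditions on the
  \<open>p\<close>-core say that it lies in \<open>S\<close> and has room for subgroups of order
  \<open>d\<close>. The induction measure falls as the domain of the map grows.\<close>

lemma fusion_controlled_by_sylow_normalizer:
  assumes S: "sylow_subgroup G p S" and d: "d = p ^ a" "d < card S"
    and abel: "\<And>H x y. \<lbrakk>subgroup H G; H \<subseteq> S; card H = p * d; x \<in> H; y \<in> H\<rbrakk> \<Longrightarrow> x \<otimes> y = y \<otimes> x"
    and chain: "\<And>K. \<lbrakk>subgroup K G; p_core (G\<lparr>carrier := K\<rparr>) p \<subseteq> S; d < card (p_core (G\<lparr>carrier := K\<rparr>) p)\<rbrakk>
      \<Longrightarrow> prime_chain (G\<lparr>carrier := K\<rparr>) (p_core (G\<lparr>carrier := K\<rparr>) p)"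
  shows "\<lbrakk>subgroup P G; P \<subseteq> S; g \<in> carrier G; conj_by g ` P \<subseteq> S\<rbrakk> \<Longrightarrow>
    \<exists>n\<in>normalizer G S. \<forall>x\<in>P. conj_by g x = conj_by n x"
proof (induction "card S - card P" arbitrary: P g rule: less_induct)
  case less
  have sS: "subgroup S G" using S by (simp add: sylow_subgroup_def)
  obtain s where s: "card S = p ^ s" using S by (auto simp: sylow_subgroup_def)
  have fS: "finite S" using sS by (rule finite_subgroup)
  have sNS: "subgroup (normalizer G S) G" using sS by (rule subgroup_normalizer)
  have NSc: "\<And>n. n \<in> normalizer G S \<Longrightarrow> n \<in> carrier G" using subgroup.mem_carrier[OF sNS] .
  have Sc: "\<And>n. n \<in> S \<Longrightarrow> n \<in> carrier G" using subgroup.mem_carrier[OF sS] .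
  have IH: "\<exists>n\<in>normalizer G S. \<forall>x\<in>B. conj_by h x = conj_by n x"
    if "subgroup B G" "B \<subseteq> S" "h \<in> carrier G" "conj_by h ` B \<subseteq> S" "card P < card B" for B h
  proof (rule less.hyps[OF _ that(1-4)])
    have "card B \<le> card S" using that(2) fS by (rule card_mono[rotated])
    then show "card S - card B < card S - card P" using that(5) by simp
  qed
  show ?case
  proof (cases "P = S")
    case True
    then have "g \<in> normalizer G S" using less.prems by (simp add: mem_normalizer[OF sS])
    then show ?thesis by blast
  next
    case False
    \<comment> \<open>Stated for all subgroups of the order of \<open>P\<close>, since it is applied
      to \<open>R\<close> as well as to the sources of maps onto \<open>R\<close>.\<close>
    have grow: "\<exists>x\<in>S - Q. conj_by x ` Q \<subseteq> Q" if Q: "subgroup Q G" "Q \<subseteq> S" "card Q = card P" for Q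
    proof -
      interpret S: finite_group_prime "G\<lparr>carrier := S\<rparr>" p using sS by (rule subgroup_finite_group_prime)
      have "P \<subset> S" using False less.prems(2) by blast
      then have "Q \<noteq> S" using Q(3) fS by (metis psubset_card_mono less_irrefl)
      then obtain x where x: "x \<in> S - Q" "\<forall>y\<in>Q. inv\<^bsub>G\<lparr>carrier := S\<rparr>\<^esub> x \<otimes> y \<otimes> x \<in> Q"
        using S.p_group_normalizer_grows[OF _ subgroup_incl[OF Q(1) sS Q(2)]] s by (auto simp: order_def)
      then have "conj_by x ` Q \<subseteq> Q" using sS by (auto simp: conj_by_def m_inv_consistent)
      then show ?thesis using x(1) by blast
    qed
    text \<open>Move \<open>P\<close> to a fully normalized conjugate \<open>R\<close>: one for which \<open>S\<close> contains a Sylow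
      subgroup \<open>T\<close> of the normalizer of \<open>R\<close>.\<close>
    let ?L = "normalizer G P"
    have sL: "subgroup ?L G" using less.prems(1) by (rule subgroup_normalizer)
    interpret L: finite_group_prime "G\<lparr>carrier := ?L\<rparr>" p using sL by (rule subgroup_finite_group_prime)
    obtain T0 where T0: "sylow_subgroup (G\<lparr>carrier := ?L\<rparr>) p T0" using L.sylow_subgroup_exists .
    obtain j m where jm: "card T0 = p ^ j" "card ?L = p ^ j * m" "\<not> p dvd m" "subgroup T0 (G\<lparr>carrier := ?L\<rparr>)"
      using T0 unfolding L.sylow_subgroup_iff by (auto simp: order_def)
    have sT0: "subgroup T0 G" "T0 \<subseteq> ?L" using incl_subgroup[OF sL jm(4)] subgroup.subset[OF jm(4)] by simp_all
    obtain i where i: "card P = p ^ i" using p_group_subgroup_card[OF less.prems(1) sS less.prems(2) s] .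
    have PT0: "P \<subseteq> T0"
      using L.normal_p_subgroup_subset_sylow[OF T0 subgroup_in_normalizer[OF less.prems(1)] i] .
    obtain h where h: "h \<in> carrier G" "\<And>x. x \<in> T0 \<Longrightarrow> inv h \<otimes> x \<otimes> h \<in> S"
      using sylow_contains_conjugate[OF S sT0(1) jm(1)] by blast
    define R where "R = conj_by h ` P"
    define T where "T = conj_by h ` T0"
    define K where "K = normalizer G R"
    have Pc: "P \<subseteq> carrier G" using less.prems(1) by (rule subgroup.subset)
    have sR: "subgroup R G" unfolding R_def using less.prems(1) h(1) by (rule subgroup_conj_by)
    have sT: "subgroup T G" unfolding T_def using sT0(1) h(1) by (rule subgroup_conj_by)
    have sK: "subgroup K G" unfolding K_def using sR by (rule subgroup_normalizer)
    have RT: "R \<subseteq> T" using PT0 by (auto simp: R_def T_def)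
    have TS: "T \<subseteq> S" using h(2) by (auto simp: T_def conj_by_def)
    have cR: "card R = card P" using h(1) Pc by (simp add: R_def card_conj_by)
    have cT: "card T = p ^ j" using h(1) sT0(1) jm(1) by (simp add: T_def card_conj_by subgroup.subset)
    have TK: "T \<subseteq> K"
      using sT0(2) conj_by_normalizer_subset[OF less.prems(1) h(1)] by (auto simp: T_def K_def R_def)
    interpret K: finite_group_prime "G\<lparr>carrier := K\<rparr>" p using sK by (rule subgroup_finite_group_prime)
    \<comment> \<open>Conjugation by \<open>h\<close> preserves the order of the normalizer, so
      \<open>T\<close> is Sylow in \<open>K\<close> just as \<open>T0\<close> is in the normalizer
      of \<open>P\<close>.\<close>
    have cK: "card K = p ^ j * m"
      using card_normalizer_conj_by[OF less.prems(1) h(1)] jm(2) by (simp add: K_def R_def)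
    have TKs: "sylow_subgroup (G\<lparr>carrier := K\<rparr>) p T"
      unfolding K.sylow_subgroup_iff using cT cK jm(3) subgroup_incl[OF sT sK TK] by (auto simp: order_def)
    have Kc: "\<And>k. k \<in> K \<Longrightarrow> k \<in> carrier G" using subgroup.mem_carrier[OF sK] .
    have Rc: "\<And>k. k \<in> R \<Longrightarrow> k \<in> carrier G" using subgroup.mem_carrier[OF sR] .
    have RS: "R \<subseteq> S" using RT TS by blast
    have RnK: "R \<lhd> G\<lparr>carrier := K\<rparr>" unfolding K_def using sR by (rule subgroup_in_normalizer)
    have into_T: "\<exists>k\<in>K. conj_by k ` Q \<subseteq> T" if Q: "subgroup Q G" "Q \<subseteq> K" "card Q = p ^ l" for Q l
    proof -
      obtain k where "k \<in> carrier (G\<lparr>carrier := K\<rparr>)"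
        "\<And>x. x \<in> Q \<Longrightarrow> inv\<^bsub>G\<lparr>carrier := K\<rparr>\<^esub> k \<otimes>\<^bsub>G\<lparr>carrier := K\<rparr>\<^esub> x \<otimes>\<^bsub>G\<lparr>carrier := K\<rparr>\<^esub> k \<in> T"
        using K.sylow_contains_conjugate[OF TKs subgroup_incl[OF Q(1) sK Q(2)] Q(3)] by blast
      then show ?thesis using sK by (auto simp: conj_by_def m_inv_consistent)
    qed
    \<comment> \<open>A \<open>p\<close>-subgroup of \<open>K\<close> containing the Sylow subgroup
      \<open>T\<close> cannot be larger than \<open>T\<close>.\<close>
    have SK: "S \<inter> K = T"
    proof -
      have sSK: "subgroup (S \<inter> K) G" using sS sK by (rule subgroups_Inter_pair)
      obtain l where l: "card (S \<inter> K) = p ^ l" using p_group_subgroup_card[OF sSK sS _ s] by blast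
      obtain k where k: "k \<in> K" "conj_by k ` (S \<inter> K) \<subseteq> T" using into_T[OF sSK _ l] by blast
      have "card (S \<inter> K) \<le> card T"
        using card_mono[OF finite_subgroup[OF sT] k(2)] card_conj_by[OF Kc[OF k(1)] subgroup.subset[OF sSK]] by simp
      then show ?thesis using TS TK finite_subgroup[OF sSK] by (metis card_seteq Int_greatest)
    qed
    \<comment> \<open>Strictness makes the induction hypothesis available for
      \<open>T\<close>.\<close>
    have RltT: "card P < card T"
    proof -
      obtain x where "x \<in> S - R" "conj_by x ` R \<subseteq> R" using grow[OF sR RS cR] by blast
      then have "x \<in> T" "x \<notin> R" using SK mem_normalizer[OF sR] Sc by (auto simp: K_def)
      then have "R \<subset> T" using RT by blast
      then show ?thesis using cR finite_subgroup[OF sT] by (metis psubset_card_mono)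
    qed
    \<comment> \<open>In both cases below \<open>k = c \<otimes> n\<close>, where \<open>c\<close>
      centralizes \<open>R\<close> and \<open>n\<close> normalizes a subgroup of \<open>S\<close>
      strictly larger than \<open>R\<close>; the induction hypothesis applies to \<open>n\<close> on
      that subgroup.\<close>
    have K_control: "\<exists>n\<in>normalizer G S. \<forall>r\<in>R. conj_by k r = conj_by n r" if k: "k \<in> K" for k
    proof -
      let ?C = "centralizer (G\<lparr>carrier := K\<rparr>) R"
      have nC: "?C \<lhd> G\<lparr>carrier := K\<rparr>" using RnK by (rule K.normal_centralizer)
      have cC: "conj_by c r = r" if "c \<in> ?C" "r \<in> R" for c r
        using that Kc by (intro conj_by_commute) (auto simp: centralizer_def Rc)
      have sC: "subgroup ?C G" using incl_subgroup[OF sK normal_imp_subgroup[OF nC]] .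
      have CK: "?C \<subseteq> K" by (auto simp: centralizer_def)
      have sCT: "subgroup (?C \<inter> T) G" using sC sT by (rule subgroups_Inter_pair)
      show ?thesis
      proof (cases "?C \<inter> T \<subseteq> R")
        case False
        have Syl: "sylow_subgroup (G\<lparr>carrier := K, carrier := ?C\<rparr>) p (?C \<inter> T)"
          using K.sylow_Int_normal[OF TKs nC] .
        obtain c n where cn: "c \<in> ?C" "n \<in> normalizer (G\<lparr>carrier := K\<rparr>) (?C \<inter> T)" "k = c \<otimes> n"
          using K.frattini[OF nC Syl, of k] k by auto
        have n: "n \<in> K" "conj_by n ` (?C \<inter> T) \<subseteq> ?C \<inter> T"
          using normalizer_in_subgroup[OF sK sCT _ cn(2)] CK by blast+
        have nR: "conj_by n ` R \<subseteq> R" using n(1) mem_normalizer[OF sR] by (simp add: K_def)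
        \<comment> \<open>The larger subgroup of the first case: \<open>n\<close> lies in
          \<open>K\<close>, so it normalizes \<open>R\<close>, and by Frattini it normalizes
          \<open>?C \<inter> T\<close>.\<close>
        let ?B = "R <#> (?C \<inter> T)"
        have sCTK: "subgroup (?C \<inter> T) (G\<lparr>carrier := K\<rparr>)" using sCT sK CK by (intro subgroup_incl) auto
        interpret B: second_isomorphism_grp R "G\<lparr>carrier := K\<rparr>" "?C \<inter> T"
          using RnK sCTK by (simp add: second_isomorphism_grp_def second_isomorphism_grp_axioms_def)
        have sB: "subgroup ?B G" using incl_subgroup[OF sK B.normal_set_mult_subgroup] by simp
        have BT: "?B \<subseteq> T" using RT subgroup.m_closed[OF sT] by (auto simp: set_mult_def)
        have "R \<subset> ?B" using B.H_contained_in_set_mult B.S_contained_in_set_mult False by auto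
        then have ltB: "card P < card ?B" using cR finite_subgroup[OF sB] by (metis psubset_card_mono)
        have "conj_by n (r \<otimes> c) = conj_by n r \<otimes> conj_by n c" if "r \<in> R" "c \<in> ?C \<inter> T" for r c
          using that Kc[OF n(1)] Rc subgroup.mem_carrier[OF sCT] by (simp add: conj_by_def m_assoc)
        then have "conj_by n ` ?B \<subseteq> ?B" using nR n(2) by (fastforce simp: set_mult_def)
        then obtain n' where n': "n' \<in> normalizer G S" "\<forall>x\<in>?B. conj_by n x = conj_by n' x"
          using IH[OF sB _ Kc[OF n(1)] _ ltB] BT TS by blast
        have "conj_by k r = conj_by n' r" if r: "r \<in> R" for r
        proof -
          have "conj_by k r = conj_by n (conj_by c r)"
            using cn CK Kc n(1) Rc[OF r] by (auto simp: conj_by_mult)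
          then show ?thesis using cC[OF cn(1) r] n'(2) r \<open>R \<subset> ?B\<close> by auto
        qed
        then show ?thesis using n'(1) by blast
      next
        case True
        let ?U = "p_core (G\<lparr>carrier := K\<rparr>) p"
        \<comment> \<open>Otherwise \<open>R\<close> lies in a subgroup \<open>A\<close> of
          \<open>S\<close> of order \<open>p * d\<close>, which is abelian and so centralizes
          \<open>R\<close>. Then \<open>A\<close> lies in \<open>?C \<inter> T\<close>, hence in
          \<open>R\<close>, which is too small.\<close>
        have "d < card R"
        proof (rule ccontr)
          assume "\<not> d < card R"
          then obtain A where A: "subgroup A G" "R \<subseteq> A" "A \<subseteq> S" "card A = p * d"
            using p_subgroup_extend_to_card[OF sS s d sR RS] by auto
          have "x \<in> ?C \<inter> T" if x: "x \<in> A" for x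
          proof -
            have comm: "x \<otimes> r = r \<otimes> x" if "r \<in> R" for r using abel[OF A(1,3,4) x] A(2) that by blast
            have xS: "x \<in> S" using A(3) x by blast
            have "conj_by x r = r" if "r \<in> R" for r
              using comm[OF that] Sc[OF xS] Rc[OF that] by (intro conj_by_commute)
            then have "x \<in> K" using Sc[OF xS] mem_normalizer[OF sR] by (auto simp: K_def)
            then show ?thesis using comm xS SK by (auto simp: centralizer_def)
          qed
          then have "A \<subseteq> R" using True by blast
          then have "p * d \<le> card R" using A(4) finite_subgroup[OF sR] card_mono by metis
          then have "p * d \<le> d" using \<open>\<not> d < card R\<close> by linarith
          then show False using d(1) prime_gt_1_nat[OF prime] by simp
        qed
        \<comment> \<open>As a normal \<open>p\<close>-subgroup of \<open>K\<close>,
          \<open>R\<close> is contained in \<open>?U\<close>. Hence \<open>?U\<close> has order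
          above \<open>d\<close>, and whatever centralizes \<open>?U\<close> centralizes
          \<open>R\<close>. The larger subgroup of this second case is \<open>T\<close>.\<close>
        note U = K.p_core_greatest
        obtain u where u: "card ?U = p ^ u" using U(2) by blast
        have "R \<subseteq> ?U" using U(3)[OF RnK] cR i by simp
        have UT: "?U \<subseteq> T" using K.normal_p_subgroup_subset_sylow[OF TKs U(1) u] .
        have "card R \<le> card ?U" using \<open>R \<subseteq> ?U\<close> UT finite_subgroup[OF sT] by (meson card_mono finite_subset)
        then have "prime_chain (G\<lparr>carrier := K\<rparr>) ?U" using chain[OF sK] UT TS \<open>d < card R\<close> by auto
        then obtain c n where cn: "c \<in> centralizer (G\<lparr>carrier := K\<rparr>) ?U" "n \<in> normalizer (G\<lparr>carrier := K\<rparr>) T" "k = c \<otimes> n"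
          using K.prime_chain_factorization[OF _ u TKs, of k] k by auto
        have cc: "c \<in> ?C" using cn(1) \<open>R \<subseteq> ?U\<close> by (auto simp: centralizer_def)
        have n: "n \<in> K" "conj_by n ` T \<subseteq> T"
          using normalizer_in_subgroup[OF sK sT TK cn(2)] by blast+
        then obtain n' where n': "n' \<in> normalizer G S" "\<forall>x\<in>T. conj_by n x = conj_by n' x"
          using IH[OF sT TS Kc[OF n(1)] _ RltT] TS by blast
        have "conj_by k r = conj_by n' r" if r: "r \<in> R" for r
        proof -
          have "conj_by k r = conj_by n (conj_by c r)"
            using cn(3) cc CK Kc n(1) Rc[OF r] by (auto simp: conj_by_mult)
          then show ?thesis using cC[OF cc r] n'(2) r RT by auto
        qed
        then show ?thesis using n'(1) by blast
      qed
    qed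
    \<comment> \<open>Choose \<open>k\<close> in \<open>K\<close> such that
      \<open>x \<otimes> k\<close> maps all of \<open>?N\<close>, which properly contains
      \<open>Q\<close>, into \<open>T\<close>. The induction hypothesis covers
      \<open>x \<otimes> k\<close> on \<open>?N\<close>, \<open>K_control\<close> covers
      \<open>k\<close> on \<open>R\<close>, and on \<open>Q\<close> conjugation by \<open>x\<close>
      is the first map followed by the inverse of the second.\<close>
    have to_R: "\<exists>n\<in>normalizer G S. \<forall>y\<in>Q. conj_by x y = conj_by n y"
      if Q: "subgroup Q G" "Q \<subseteq> S" "card Q = card P" and x: "x \<in> carrier G" "conj_by x ` Q = R" for Q x
    proof -
      let ?N = "S \<inter> normalizer G Q"
      have sN: "subgroup ?N G" using sS subgroup_normalizer[OF Q(1)] by (rule subgroups_Inter_pair)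
      have QN: "Q \<subseteq> ?N" using Q(2) subgroup_subset_normalizer[OF Q(1)] by blast
      obtain z where "z \<in> S - Q" "conj_by z ` Q \<subseteq> Q" using grow[OF Q] by blast
      then have "z \<in> ?N" "z \<notin> Q" using mem_normalizer[OF Q(1)] Sc by auto
      then have "Q \<subset> ?N" using QN by blast
      then have ltN: "card P < card ?N" using Q(3) finite_subgroup[OF sN] by (metis psubset_card_mono)
      obtain l where l: "card ?N = p ^ l" using p_group_subgroup_card[OF sN sS _ s] by blast
      have "conj_by x ` ?N \<subseteq> K"
        using conj_by_normalizer_subset[OF Q(1) x(1)] x(2) by (auto simp: K_def)
      moreover have "card (conj_by x ` ?N) = p ^ l"
        using l card_conj_by[OF x(1) subgroup.subset[OF sN]] by simp
      ultimately obtain k where k: "k \<in> K" "conj_by k ` conj_by x ` ?N \<subseteq> T"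
        using into_T[OF subgroup_conj_by[OF sN x(1)]] by blast
      have "conj_by (x \<otimes> k) y = conj_by k (conj_by x y)" if "y \<in> ?N" for y
        using that x(1) Kc[OF k(1)] Sc by (simp add: conj_by_mult)
      then have *: "conj_by (x \<otimes> k) ` ?N \<subseteq> S" using k(2) TS by auto
      obtain n where n: "n \<in> normalizer G S" "\<forall>y\<in>?N. conj_by (x \<otimes> k) y = conj_by n y"
        using IH[OF sN _ _ * ltN] x(1) Kc[OF k(1)] by auto
      obtain n' where n': "n' \<in> normalizer G S" "\<forall>r\<in>R. conj_by k r = conj_by n' r"
        using K_control[OF k(1)] by blast
      have "conj_by x y = conj_by (n \<otimes> inv n') y" if y: "y \<in> Q" for y
      proof -
        have yc: "y \<in> carrier G" using Q(2) y Sc by blast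
        have "conj_by x y \<in> R" using x(2) y by blast
        then have "conj_by n' (conj_by x y) = conj_by k (conj_by x y)" using n'(2) by simp
        also have "\<dots> = conj_by (x \<otimes> k) y" using x(1) Kc[OF k(1)] yc by (simp add: conj_by_mult)
        also have "\<dots> = conj_by n y" using n(2) y QN by blast
        finally have "conj_by (inv n') (conj_by n' (conj_by x y)) = conj_by (inv n') (conj_by n y)" by simp
        then show ?thesis using NSc[OF n(1)] NSc[OF n'(1)] x(1) yc by (simp add: conj_by_mult)
      qed
      moreover have "n \<otimes> inv n' \<in> normalizer G S"
        using subgroup.m_closed[OF sNS n(1) subgroup.m_inv_closed[OF sNS n'(1)]] .
      ultimately show ?thesis by blast
    qed
    \<comment> \<open>Both \<open>P\<close> and its image under \<open>g\<close> are carried onto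
      \<open>R\<close>, by \<open>h\<close> and by \<open>inv g \<otimes> h\<close>. Conjugation by
      \<open>g\<close> is the first map followed by the inverse of the second, and
      \<open>to_R\<close> covers both.\<close>
    obtain n1 where n1: "n1 \<in> normalizer G S" "\<forall>y\<in>P. conj_by h y = conj_by n1 y"
      using to_R[OF less.prems(1,2) refl h(1)] by (auto simp: R_def)
    let ?Q = "conj_by g ` P"
    have "conj_by (inv g \<otimes> h) (conj_by g y) = conj_by h y" if "y \<in> P" for y
      using that Pc less.prems(3) h(1) by (simp add: conj_by_mult subset_iff)
    note gh = this
    then have "conj_by (inv g \<otimes> h) ` ?Q = R" by (simp add: R_def image_image)
    moreover have "inv g \<otimes> h \<in> carrier G" "card ?Q = card P"
      using less.prems(3) h(1) Pc by (simp_all add: card_conj_by)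
    ultimately obtain n2 where n2: "n2 \<in> normalizer G S" "\<forall>y\<in>?Q. conj_by (inv g \<otimes> h) y = conj_by n2 y"
      using to_R[OF subgroup_conj_by[OF less.prems(1,3)] less.prems(4)] by blast
    have "conj_by g y = conj_by (n1 \<otimes> inv n2) y" if y: "y \<in> P" for y
    proof -
      have yc: "y \<in> carrier G" using y Pc by blast
      have "conj_by n2 (conj_by g y) = conj_by n1 y" using n1(2) n2(2) gh y by auto
      then have "conj_by (inv n2) (conj_by n2 (conj_by g y)) = conj_by (inv n2) (conj_by n1 y)" by simp
      then show ?thesis using NSc[OF n1(1)] NSc[OF n2(1)] less.prems(3) yc by (simp add: conj_by_mult)
    qed
    moreover have "n1 \<otimes> inv n2 \<in> normalizer G S"
      using subgroup.m_closed[OF sNS n1(1) subgroup.m_inv_closed[OF sNS n2(1)]] .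
    ultimately show ?thesis by blast
  qed
qed

end

text \<open>Unfolds the inductive predicate into an indexed series, the format of
  \<open>supersolvable_fusion\<close>.\<close>

lemma (in finite_group_prime) prime_chain_series:
  "prime_chain G N \<Longrightarrow> \<exists>n T. T 0 = {\<one>} \<and> T n = N \<and> (\<forall>i\<le>n. T i \<lhd> G \<and> T i \<subseteq> N) \<and>
     (\<forall>i<n. T i \<subseteq> T (Suc i) \<and> (\<exists>q. prime q \<and> card (T (Suc i)) = q * card (T i)))"
proof (induction rule: prime_chain.induct)
  case one
  then show ?case by (intro exI[of _ 0] exI[of _ "\<lambda>_. {\<one>}"]) (simp add: one_is_normal)
next
  case (step N M q)
  then obtain n T where T: "T 0 = {\<one>}" "T n = N" "\<forall>i\<le>n. T i \<lhd> G \<and> T i \<subseteq> N"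
    "\<forall>i<n. T i \<subseteq> T (Suc i) \<and> (\<exists>q. prime q \<and> card (T (Suc i)) = q * card (T i))" by blast
  then have "\<forall>i\<le>n. T i \<lhd> G \<and> T i \<subseteq> M" using step.hyps(3) by blast
  then show ?case using T step.hyps
    by (intro exI[of _ "Suc n"] exI[of _ "T(Suc n := M)"]) (auto simp: le_Suc_eq less_Suc_eq)
qed

text \<open>Oddness of \<open>p\<close> gives access to the second clause of
  \<open>six_eternal\<close>, which speaks of odd primes.\<close>

theorem theorem3p11:
  fixes R :: "'a set \<Rightarrow> 'a monoid \<Rightarrow> bool"
    and G :: "'a monoid" and p :: nat and S :: "'a set"
  assumes "six_eternal R"
    and "group G" and "finite (carrier G)"
    and "Factorial_Ring.prime p" and "p dvd Coset.order G" and "odd p"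
    and "sylow_subgroup G p S"
    and "\<exists>D. subgroup D (G\<lparr>carrier := S\<rparr>) \<and> 1 \<le> card D \<and> card D < card S \<and>
           (\<forall>H. subgroup H (G\<lparr>carrier := S\<rparr>) \<and> (card H = card D \<or> card H = p * card D) \<longrightarrow>
              comm_group (G\<lparr>carrier := H\<rparr>)) \<and>
           (\<forall>H. subgroup H (G\<lparr>carrier := S\<rparr>) \<and> card H = card D \<longrightarrow> R H G)"
  shows "supersolvable_fusion (G\<lparr>carrier := S\<rparr>) (group_fusion G S)"
proof -
  interpret finite_group_prime G p
    using assms(2-4) by (simp add: finite_group_prime_def finite_group_prime_axioms_def)
  have sS: "subgroup S G" using assms(7) by (simp add: sylow_subgroup_def)
  obtain s where s: "card S = p ^ s" using assms(7) by (auto simp: sylow_subgroup_def)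
  obtain D where D: "subgroup D (G\<lparr>carrier := S\<rparr>)" "card D < card S"
    "\<And>H. \<lbrakk>subgroup H (G\<lparr>carrier := S\<rparr>); card H = p * card D\<rbrakk> \<Longrightarrow> comm_group (G\<lparr>carrier := H\<rparr>)"
    "\<And>H. \<lbrakk>subgroup H (G\<lparr>carrier := S\<rparr>); card H = card D\<rbrakk> \<Longrightarrow> R H G"
    using assms(8) by blast
  have "subgroup D G" "D \<subseteq> S" using incl_subgroup[OF sS D(1)] subgroup.subset[OF D(1)] by simp_all
  then obtain a where a: "card D = p ^ a" using p_group_subgroup_card[OF _ sS _ s] by blast
  have abel: "x \<otimes>\<^bsub>G\<^esub> y = y \<otimes>\<^bsub>G\<^esub> x"
    if "subgroup H G" "H \<subseteq> S" "card H = p * card D" "x \<in> H" "y \<in> H" for H x y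
    using comm_groupE(4)[OF D(3)[OF subgroup_incl[OF that(1) sS that(2)] that(3)]] that by simp
  \<comment> \<open>Subgroups of order \<open>card D\<close> in the \<open>p\<close>-core of
    \<open>K\<close> are subgroups of \<open>S\<close>. They are related to \<open>G\<close> by
    hypothesis and to \<open>K\<close> by the first clause of \<open>six_eternal\<close>; the second
    clause, applied to \<open>K\<close>, then puts the \<open>p\<close>-core into the
    hypercenter.\<close>
  have chain: "prime_chain (G\<lparr>carrier := K\<rparr>) (p_core (G\<lparr>carrier := K\<rparr>) p)"
    if K: "subgroup K G" and US: "p_core (G\<lparr>carrier := K\<rparr>) p \<subseteq> S"
      and lt: "card D < card (p_core (G\<lparr>carrier := K\<rparr>) p)" for K
  proof -
    let ?K = "G\<lparr>carrier := K\<rparr>"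
    let ?U = "p_core ?K p"
    interpret K: finite_group_prime ?K p using K by (rule subgroup_finite_group_prime)
    have nU: "?U \<lhd> ?K" by (rule K.p_core_greatest)
    obtain u where u: "card ?U = p ^ u" using K.p_core_greatest by blast
    have sUK: "subgroup ?U ?K" using nU by (rule normal_imp_subgroup)
    have sU: "subgroup ?U G" using K sUK by (rule incl_subgroup)
    have "p ^ a < p ^ u" using lt a u by simp
    then have "a < u" by (rule power_less_imp_less_exp[OF prime_gt_1_nat[OF prime]])
    then have "order (G\<lparr>carrier := ?U\<rparr>) = p ^ a * p ^ (u - a)"
      by (simp add: order_def u flip: power_add)
    \<comment> \<open>\<open>D\<close> itself need not lie in \<open>?U\<close>, but the second
      clause asks for a subgroup there, so Sylow's theorem supplies one of the same order.\<close>
    then obtain E where E: "subgroup E (G\<lparr>carrier := ?U\<rparr>)" "card E = card D"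
      using sylow_thm[OF prime subgroup_imp_group[OF sU], of a] finite_subgroup[OF sU] a by auto
    have "1 \<le> card E" using E(2) a prime_gt_0_nat[OF prime] by simp
    have "p dvd card ?U" using u \<open>a < u\<close> by simp
    then have "p dvd order ?K"
      using K.card_subgroup_dvd[OF sUK K.subgroup_self] subgroup.subset[OF sUK]
      by (auto simp: order_def intro: dvd_trans)
    have "R H ?K" if H: "subgroup H (G\<lparr>carrier := ?U\<rparr>)" "card H = card E" for H
    proof -
      have H': "subgroup H G" "H \<subseteq> ?U" using incl_subgroup[OF sU H(1)] subgroup.subset[OF H(1)] by simp_all
      have "R H G" using H(2) E(2) US H' subgroup_incl[OF H'(1) sS] by (intro D(4)) auto
      moreover have "subgroup H ?K"
        using subgroup_incl[OF H'(1) K] H'(2) subgroup.subset[OF sUK] by auto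
      ultimately show ?thesis using assms(1) K group_axioms finite_carrier unfolding six_eternal_def by blast
    qed
    then have "\<exists>D. subgroup D (?K\<lparr>carrier := ?U\<rparr>) \<and> 1 \<le> card D \<and> card D < card ?U \<and>
        (\<forall>H. subgroup H (?K\<lparr>carrier := ?U\<rparr>) \<and> card H = card D \<longrightarrow> R H ?K)"
      using E \<open>1 \<le> card E\<close> lt by (intro exI[of _ E]) simp
    moreover have "group ?K \<and> finite (carrier ?K)" using K.group_axioms K.finite_carrier by blast
    ultimately have "?U \<subseteq> supersolvable_hypercenter ?K"
      using assms(1) \<open>p dvd order ?K\<close> prime assms(6) unfolding six_eternal_def by blast
    then show ?thesis
      using K.prime_chain_subset[OF K.prime_chain_supersolvable_hypercenter nU] by blast
  qed
  let ?N = "normalizer G S"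
  have sN: "subgroup ?N G" using sS by (rule subgroup_normalizer)
  interpret N: finite_group_prime "G\<lparr>carrier := ?N\<rparr>" p using sN by (rule subgroup_finite_group_prime)
  have control: "\<exists>n\<in>?N. \<forall>x\<in>P. conj_by g x = conj_by n x"
    if "subgroup P G" "P \<subseteq> S" "g \<in> carrier G" "conj_by g ` P \<subseteq> S" for P g
    using abel chain that by (rule fusion_controlled_by_sylow_normalizer[OF assms(7) a D(2)])
  \<comment> \<open>This is \<open>S\<close> itself: \<open>S\<close> is a normal
    \<open>p\<close>-subgroup of its normalizer, and a conjugate of \<open>?U\<close> lies in
    \<open>S\<close>. So \<open>chain\<close> applies to \<open>S\<close> with
    \<open>K = ?N\<close>.\<close>
  let ?U = "p_core (G\<lparr>carrier := ?N\<rparr>) p"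
  have "S \<subseteq> ?U" using N.p_core_greatest(3)[OF subgroup_in_normalizer[OF sS] s] .
  moreover have "card ?U \<le> card S"
  proof -
    have sU: "subgroup ?U G"
      using sN normal_imp_subgroup[OF N.p_core_greatest(1)] by (rule incl_subgroup)
    obtain u where u: "card ?U = p ^ u" using N.p_core_greatest by blast
    obtain g where g: "g \<in> carrier G" "\<And>x. x \<in> ?U \<Longrightarrow> inv\<^bsub>G\<^esub> g \<otimes>\<^bsub>G\<^esub> x \<otimes>\<^bsub>G\<^esub> g \<in> S"
      using sylow_contains_conjugate[OF assms(7) sU u] by blast
    then have "conj_by g ` ?U \<subseteq> S" by (auto simp: conj_by_def)
    then show ?thesis
      using card_mono[OF finite_subgroup[OF sS]] card_conj_by[OF g(1) subgroup.subset[OF sU]] by metis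
  qed
  moreover have "finite ?U"
    using N.finite_subgroup[OF normal_imp_subgroup[OF N.p_core_greatest(1)]] .
  ultimately have US: "?U = S" by (metis card_seteq)
  have "prime_chain (G\<lparr>carrier := ?N\<rparr>) S" using chain[OF sN] US D(2) by simp
  then obtain n T where T: "T 0 = {\<one>\<^bsub>G\<^esub>}" "T n = S" "\<And>i. i \<le> n \<Longrightarrow> T i \<lhd> G\<lparr>carrier := ?N\<rparr>"
    "\<And>i. i \<le> n \<Longrightarrow> T i \<subseteq> S" "\<And>i. i < n \<Longrightarrow> T i \<subseteq> T (Suc i)"
    "\<And>i. i < n \<Longrightarrow> \<exists>q. prime q \<and> card (T (Suc i)) = q * card (T i)"
    using N.prime_chain_series[of S] by auto
  have sT: "subgroup (T i) G" if "i \<le> n" for i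
    using sN normal_imp_subgroup[OF T(3)[OF that]] by (rule incl_subgroup)
  \<comment> \<open>By \<open>control\<close> every morphism of the fusion system is conjugation by
    an element \<open>m\<close> of \<open>?N\<close>, and \<open>T i\<close> is normal in
    \<open>?N\<close>.\<close>
  have "strongly_closed (G\<lparr>carrier := S\<rparr>) (group_fusion G S) (T i)" if i: "i \<le> n" for i
    unfolding strongly_closed_def
  proof (intro conjI allI impI ballI)
    show "subgroup (T i) (G\<lparr>carrier := S\<rparr>)" using sT[OF i] sS T(4)[OF i] by (rule subgroup_incl)
    fix P \<phi>
    assume "subgroup P (G\<lparr>carrier := S, carrier := T i\<rparr>)"
      and \<phi>: "\<phi> \<in> group_fusion G S P (carrier (G\<lparr>carrier := S\<rparr>))"
    then have PT: "subgroup P (G\<lparr>carrier := T i\<rparr>)" by simp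
    then have sP: "subgroup P G" "P \<subseteq> T i" using incl_subgroup[OF sT[OF i]] subgroup.subset by force+
    obtain g where g: "g \<in> carrier G" "\<phi> = restrict (conj_by g) P" "conj_by g ` P \<subseteq> S"
      using \<phi> by (auto simp: group_fusion_def conj_by_def[abs_def])
    obtain m where m: "m \<in> ?N" "\<forall>x\<in>P. conj_by g x = conj_by m x"
      using control[OF sP(1) _ g(1,3)] sP(2) T(4)[OF i] by blast
    have "conj_by m x \<in> T i" if "x \<in> P" for x
      using normal.inv_op_closed1[OF T(3)[OF i], of m x] m(1) that sP(2) sN
      by (auto simp: conj_by_def m_inv_consistent)
    then show "\<phi> ` P \<subseteq> T i" using g(2) m(2) by auto
  qed
  \<comment> \<open>Normality of \<open>T i\<close> is known in \<open>?N\<close>, so the quotient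
    is treated there; the nested \<open>carrier\<close> updates collapse to the quotient
    wanted.\<close>
  moreover have "cyclic_group (G\<lparr>carrier := T (Suc i)\<rparr> Mod T i)" if i: "i < n" for i
  proof -
    obtain q where q: "prime q" "card (T (Suc i)) = q * card (T i)" using T(6)[OF i] by blast
    have "subgroup (T (Suc i)) (G\<lparr>carrier := ?N\<rparr>)" "T i \<lhd> G\<lparr>carrier := ?N\<rparr>"
      using T(3) i by (auto intro: normal_imp_subgroup)
    from N.cyclic_FactGroup_of_prime_index(1)[OF this T(5)[OF i] q(2,1)] show ?thesis by simp
  qed
  ultimately show ?thesis
    unfolding supersolvable_fusion_def using T(1,2,5)
    by (intro exI[of _ n] exI[of _ T]) simp
qed

end
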